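(* Let $q$ be a power of an odd prime and let $S$ be a multiplicative character on $\mathbb{F}_q$ whose order is not equal to $3$. Suppose $S$ is the square of some character on $\mathbb{F}_q$. If $q\equiv 2\pmod 3$, then $${}_2F_1\left(\begin{array}{cc}\sqrt{S^{-3}}\phi, & \sqrt{S^{-3}}\\ & S^{-2}\end{array}\Big|\ \tfrac43\right)={}_2F_1\left(\begin{array}{cc}\sqrt{S^{-3}}\phi, & \sqrt{S^{-3}}\\ & S^{-1}\phi\end{array}\Big|\ -\tfrac13\right)={}_2F_1\left(\begin{array}{cc}\sqrt{S^{-3}}\phi, & \sqrt{S^{-1}}\\ & S^{-2}\end{array}\Big|\ 4\right)={}_2F_1\left(\begin{array}{cc}\sqrt{S^{-3}}\phi, & \sqrt{S}\phi\\ & S^{-1}\phi\end{array}\Big|\ \tfrac14\right)=0.$$ If $q\equiv 1\pmod 3$ and $\chi_3$ is a character of order $3$ on $\mathbb{F}_q$, then (i) $${}_2F_1\left(\begin{array}{cc}\sqrt{S^{-3}}\phi, & \sqrt{S^{-3}}\\ & S^{-2}\end{array}\Big|\ \tfrac43\right)=\frac{S(\frac{8}{27})J(\sqrt{S^{-1}},\sqrt{S^3}\phi)}{J(\phi,S)}\left[\binom{S}{\chi_3}+\binom{S}{\chi_3^2}\right];$$ (ii) $${}_2F_1\left(\begin{array}{cc}\sqrt{S^{-3}}\phi, & \sqrt{S^{-3}}\\ & S^{-1}\phi\end{array}\Big|\ -\tfrac13\right)=\frac{S(\frac{8}{27})J(\sqrt{S^{-1}},\sqrt{S^3}\phi)}{\sqrt{S}\phi(-1)J(\phi,S)}\left[\binom{S}{\chi_3}+\binom{S}{\chi_3^2}\right];$$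 (iii) $${}_2F_1\left(\begin{array}{cc}\sqrt{S^{-3}}\phi, & \sqrt{S^{-1}}\\ & S^{-2}\end{array}\Big|\ 4\right)=\frac{\sqrt{S}(-\frac{64}{27})J(\sqrt{S^{-1}},\sqrt{S^3}\phi)}{\phi(-3)J(\phi,S)}\left[\binom{S}{\chi_3}+\binom{S}{\chi_3^2}\right];$$ (iv) $${}_2F_1\left(\begin{array}{cc}\sqrt{S^{-3}}\phi, & \sqrt{S}\phi\\ & S^{-1}\phi\end{array}\Big|\ \tfrac14\right)=\frac{\sqrt{S}(-\frac{1}{27})J(\sqrt{S^{-1}},\sqrt{S^3}\phi)}{\phi(3)J(\phi,S)}\left[\binom{S}{\chi_3}+\binom{S}{\chi_3^2}\right].$$
   Context: Multiplicative characters on $\mathbb{F}_q^\times$ are complex valued and are all (including the trivial one) extended to $\mathbb{F}_q$ by $\chi(0):=0$; $\phi$ is the quadratic character; $\overline{B}$ is the inverse of $B$. $J(A,B)=\sum_{x\in\mathbb{F}_q}A(x)B(1-x)$ is the Jacobi sum. The binomial coefficient is $\binom{A}{B}:=\frac{B(-1)}{q}J(A,\overline{B})$. Gaussian hypergeometric series over $\mathbb{F}_q$: $${}_2F_1\left(\begin{array}{cc}A_0,&A_1\\&B_1\end{array}\Big|\ x\right):=\frac{q}{q-1}\sum_{\chi}\binom{A_0\chi}{\chi}\binom{A_1\chi}{B_1\chi}\chi(x),$$ the sum being over all multiplicative characters $\chi$ of $\mathbb{F}_q$. $\sqrt{S}$ denotes a character whose square is $S$, and $\sqrt{S^k}=(\sqrt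 S)^k$ for integers $k$; $\sqrt{S}\phi(-1)$ means $\sqrt S(-1)\phi(-1)$. Rational numbers with denominator prime to $q$ are regarded as elements of $\mathbb{F}_q$. *)

theory Defs
  imports Complex_Main "HOL-Library.FuncSet" "HOL-Library.Cardinality" "HOL-Computational_Algebra.Primes"
begin

text \<open>
  A finite field \<open>\<F>\<^sub>q\<close> is a type \<open>'a :: {field, finite}\<close> with \<open>q = CARD('a)\<close>.
  A multiplicative character is a function on all of \<open>\<F>\<^sub>q\<close>, extended by \<open>0\<close> at \<open>0\<close>;
  this includes the trivial character.
\<close>

definition mult_char :: "('a :: {field, finite} \<Rightarrow> complex) \<Rightarrow> bool" where
  "mult_char \<chi> \<longleftrightarrow> \<chi> 0 = 0 \<and> \<chi> 1 = 1 \<and> (\<forall>x y. \<chi> (x * y) = \<chi> x * \<chi> y)"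

definition trivial_char :: "'a :: {field, finite} \<Rightarrow> complex" where
  "trivial_char x = (if x = 0 then 0 else 1)"

definition quad_char :: "'a :: {field, finite} \<Rightarrow> complex" where
  "quad_char x = (if x = 0 then 0 else if \<exists>y. x = y ^ 2 then 1 else -1)"

definition char_mult ::
    "('a :: {field, finite} \<Rightarrow> complex) \<Rightarrow> ('a \<Rightarrow> complex) \<Rightarrow> 'a \<Rightarrow> complex"
    (infixl "\<cdot>\<^sub>c" 70) where
  "(A \<cdot>\<^sub>c B) x = A x * B x"

text \<open>
  The case distinction keeps the convention \<open>\<chi>(0) = 0\<close> for \<open>k = 0\<close>, since \<open>0 powi 0 = 1\<close>.
  The inverse character is the power with exponent \<open>-1\<close>.
\<close>

definition char_pow :: "('a :: {field, finite} \<Rightarrow> complex) \<Rightarrow> int \<Rightarrow> 'a \<Rightarrow> complex"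
    (infixr "^\<^sub>c" 80) where
  "(\<chi> ^\<^sub>c k) x = (if x = 0 then 0 else \<chi> x powi k)"

definition char_order :: "('a :: {field, finite} \<Rightarrow> complex) \<Rightarrow> nat" where
  "char_order \<chi> = (LEAST n. n > 0 \<and> \<chi> ^\<^sub>c int n = trivial_char)"

definition jacobi_sum ::
    "('a :: {field, finite} \<Rightarrow> complex) \<Rightarrow> ('a \<Rightarrow> complex) \<Rightarrow> complex" where
  "jacobi_sum A B = (\<Sum>x\<in>UNIV. A x * B (1 - x))"

definition char_binom ::
    "('a :: {field, finite} \<Rightarrow> complex) \<Rightarrow> ('a \<Rightarrow> complex) \<Rightarrow> complex" where
  "char_binom A B = B (- 1) / of_nat CARD('a) * jacobi_sum A (B ^\<^sub>c (-1))"

definition gauss_2F1 ::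
    "('a :: {field, finite} \<Rightarrow> complex) \<Rightarrow> ('a \<Rightarrow> complex) \<Rightarrow> ('a \<Rightarrow> complex) \<Rightarrow> 'a \<Rightarrow> complex" where
  "gauss_2F1 A\<^sub>0 A\<^sub>1 B\<^sub>1 x =
     of_nat CARD('a) / (of_nat CARD('a) - 1) *
     (\<Sum>\<chi> | mult_char \<chi>.
        char_binom (A\<^sub>0 \<cdot>\<^sub>c \<chi>) \<chi> * char_binom (A\<^sub>1 \<cdot>\<^sub>c \<chi>) (B\<^sub>1 \<cdot>\<^sub>c \<chi>) * \<chi> x)"

text \<open>The sum over all characters ranges over a finite set, so it is not \<open>0\<close> by convention.\<close>

lemma finite_mult_char: "finite {\<chi> :: 'a :: {field, finite} \<Rightarrow> complex. mult_char \<chi>}"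
proof -
  let ?V = "insert 0 (\<Union>n\<in>{1..CARD('a)}. {z :: complex. z ^ n = 1})"
  have fin: "finite ?V"
    by (auto intro!: finite_roots_unity)
  have "\<chi> x \<in> ?V" if \<chi>: "mult_char \<chi>" for \<chi> :: "'a \<Rightarrow> complex" and x
  proof (cases "x = 0")
    case True
    then show ?thesis using \<chi> by (simp add: mult_char_def)
  next
    case False
    have "\<not> inj_on (\<lambda>i. x ^ i) {0..CARD('a)}"
    proof
      assume "inj_on (\<lambda>i. x ^ i) {0..CARD('a)}"
      then have "card {0..CARD('a)} \<le> CARD('a)"
        by (rule card_inj_on_le) auto
      then show False by simp
    qed
    then obtain i j where ij: "i < j" "j \<le> CARD('a)" "x ^ i = x ^ j"
      by (auto simp: inj_on_def) (metis nat_neq_iff)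
    have "x ^ i * x ^ (j - i) = x ^ i"
      using ij power_add [of x i "j - i"] by simp
    then have 1: "x ^ (j - i) = 1"
      using False by simp
    have "\<chi> (x ^ n) = \<chi> x ^ n" for n
      using \<chi> by (induction n) (simp_all add: mult_char_def)
    then have "\<chi> x ^ (j - i) = 1"
      using 1 \<chi> by (metis mult_char_def)
    moreover have "j - i \<in> {1..CARD('a)}"
      using ij by auto
    ultimately show ?thesis by blast
  qed
  then have "{\<chi>. mult_char \<chi>} \<subseteq> (UNIV :: 'a set) \<rightarrow>\<^sub>E ?V"
    by (auto simp: PiE_def)
  moreover have "finite ((UNIV :: 'a set) \<rightarrow>\<^sub>E ?V)"
    using fin by (intro finite_PiE) auto
  ultimately show ?thesis
    by (rule finite_subset)
qed

end

theory Submission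
  imports "HOL-Algebra.Algebraic_Closure_Type" "HOL-Number_Theory.Residues" Defs
begin

text \<open>
  Write \<open>\<phi>\<close> for the quadratic character. Orthogonality of characters turns each of the four series into a
  one-dimensional (Euler-type) sum. A Moebius substitution, a different one for each series, reduces all four to the
  same sum \<open>E = \<Sum>\<^sub>t \<phi>(t) T(t / ((1 - t)\<^sup>3 (3 + t)))\<close>, up to explicit character values.
  On the other hand the substitution \<open>y = (r + 1) / (r - 1)\<close> and the evaluation of a quadratic analogue of
  \<open>\<^sub>2F\<^sub>1(a, a + 1/2; 1/2; z)\<close> relate \<open>E\<close> to \<open>M = \<Sum>\<^sub>y S(1 - y\<^sup>3)\<close> by a factor made of Jacobi sums.
  If \<open>q \<equiv> 2 (mod 3)\<close> cubing is a bijection, so \<open>M = \<Sum>\<^sub>x S(x)\<close>; if \<open>q \<equiv> 1 (mod 3)\<close>, the number of cube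
  roots of \<open>x\<close> is \<open>1 + \<chi>\<^sub>3(x) + \<chi>\<^sub>3\<^sup>2(x)\<close>, which produces the two binomial coefficients. When \<open>S\<close> is
  trivial the Jacobi sums degenerate and both sides are computed directly.
\<close>

section \<open>Characters of a finite field\<close>

text \<open>An Euler-type sum at argument x has singular points 0, 1, 1/x and infinity;
  \<open>E\<close> has 0, 1, -3 and infinity, whose cross-ratios form the orbit 4, 1/4, -3, -1/3,
  3/4, 4/3. The arguments of the four series lie in this orbit, so a Moebius map can match the
  points, and the characters attached to the points dictate which one. The first parameter is common
  to the four series, which makes 1/x carry the same character each time, so 1/x always goes to
  infinity.

  The factor between \<open>E\<close> and \<open>M\<close> first appears as J(\<phi>, B) / J(S, B)
  with B = T^(-3). Gauss sums are avoided: an exchange identity for products of two Jacobi sums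
  converts this quotient, and the final cancellation rests on the nonvanishing of Jacobi sums of
  nontrivial characters. If \<open>S\<close> had order 3, then T^3 would be trivial or quadratic, so
  \<open>B\<close> or \<phi> B would be trivial and the argument would break down. This is where the
  condition on the order of \<open>S\<close> enters.\<close>

lemma char_zero: "mult_char \<chi> \<Longrightarrow> \<chi> 0 = 0"
  and char_one: "mult_char \<chi> \<Longrightarrow> \<chi> 1 = 1"
  and char_times: "mult_char \<chi> \<Longrightarrow> \<chi> (x * y) = \<chi> x * \<chi> y"
  by (simp_all add: mult_char_def)

lemma char_eq_0_iff:
  assumes "mult_char \<chi>" shows "\<chi> x = 0 \<longleftrightarrow> x = 0"
proof
  assume "\<chi> x = 0"
  show "x = 0"
  proof (rule ccontr)
    assume "x \<noteq> 0"
    then have "\<chi> x * \<chi> (inverse x) = 1"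
      using assms by (metis char_one char_times right_inverse)
    then show False using \<open>\<chi> x = 0\<close> by simp
  qed
qed (simp add: assms char_zero)

lemma char_inverse:
  assumes "mult_char \<chi>" shows "\<chi> (inverse x) = inverse (\<chi> x)"
proof (cases "x = 0")
  case False
  then have "\<chi> x * \<chi> (inverse x) = 1"
    using assms by (metis char_one char_times right_inverse)
  then show ?thesis by (simp add: inverse_unique)
qed (simp add: assms char_zero)

lemma char_divide: "mult_char \<chi> \<Longrightarrow> \<chi> (x / y) = \<chi> x / \<chi> y"
  by (simp add: divide_inverse char_times char_inverse)

lemma char_power: "mult_char \<chi> \<Longrightarrow> \<chi> (x ^ n) = \<chi> x ^ n"
  by (induction n) (simp_all add: char_one char_times)

lemma char_uminus: "mult_char \<chi> \<Longrightarrow> \<chi> (- x) = \<chi> (- 1) * \<chi> x"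
  using char_times [of \<chi> "- 1" x] by simp

lemma char_minus_one_mult_self: "mult_char \<chi> \<Longrightarrow> \<chi> (- 1) * \<chi> (- 1) = 1"
  using char_times [of \<chi> "- 1" "- 1"] by (simp add: char_one)

lemmas char_simps = char_zero char_one char_times char_inverse char_divide char_power

lemma mult_char_trivial: "mult_char trivial_char"
  by (simp add: mult_char_def trivial_char_def)

lemma mult_char_char_mult: "mult_char A \<Longrightarrow> mult_char B \<Longrightarrow> mult_char (A \<cdot>\<^sub>c B)"
  by (simp add: mult_char_def char_mult_def)

lemma mult_char_char_pow: "mult_char A \<Longrightarrow> mult_char (A ^\<^sub>c k)"
  by (simp add: mult_char_def char_pow_def power_int_mult_distrib)

lemma char_pow_minus_one: "mult_char A \<Longrightarrow> (A ^\<^sub>c (-1)) x = A (inverse x)"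
  by (simp add: char_pow_def char_inverse char_zero)

lemma sum_nontrivial_char:
  assumes "mult_char \<chi>" "\<chi> \<noteq> trivial_char"
  shows "(\<Sum>x\<in>UNIV. \<chi> x) = 0"
proof -
  have "\<exists>a. a \<noteq> 0 \<and> \<chi> a \<noteq> 1"
  proof (rule ccontr)
    assume "\<not> ?thesis"
    then have "\<chi> = trivial_char"
      using assms(1) by (auto simp: fun_eq_iff trivial_char_def char_zero)
    then show False using assms(2) by simp
  qed
  then obtain a where a: "a \<noteq> 0" "\<chi> a \<noteq> 1" by blast
  have "(\<Sum>x\<in>UNIV. \<chi> x) = (\<Sum>x\<in>UNIV. \<chi> (a * x))"
    by (rule sum.reindex_bij_witness [of _ "\<lambda>x. a * x" "\<lambda>x. x / a"]) (use a in auto)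
  also have "\<dots> = \<chi> a * (\<Sum>x\<in>UNIV. \<chi> x)"
    using assms(1) by (simp add: char_times sum_distrib_left)
  finally show ?thesis using a(2) by auto
qed

lemma sum_trivial_char:
  "(\<Sum>x\<in>UNIV. trivial_char (x :: 'a :: {field, finite})) = of_nat CARD('a) - 1"
proof -
  have "(\<Sum>x\<in>UNIV. trivial_char (x :: 'a)) = (\<Sum>x\<in>UNIV - {0 :: 'a}. 1)"
    by (rule sum.mono_neutral_cong_right) (auto simp: trivial_char_def)
  then show ?thesis by (simp add: card_Diff_singleton of_nat_diff)
qed

section \<open>The cyclic group of units and orthogonality of characters\<close>

lemma power_card_minus_one:
  fixes x :: "'a :: {field, finite}"
  assumes "x \<noteq> 0" shows "x ^ (CARD('a) - 1) = 1"
proof -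
  have "(\<Prod>y\<in>UNIV - {0}. x * y) = (\<Prod>y\<in>UNIV - {0 :: 'a}. y)"
    by (rule prod.reindex_bij_witness [of _ "\<lambda>y. y / x" "\<lambda>y. x * y"]) (use assms in auto)
  then have "x ^ (CARD('a) - 1) * \<Prod>(UNIV - {0}) = 1 * \<Prod>(UNIV - {0 :: 'a})"
    by (simp add: prod.distrib card_Diff_singleton)
  moreover have "\<Prod>(UNIV - {0 :: 'a}) \<noteq> 0" by simp
  ultimately show ?thesis by (metis mult_right_cancel)
qed

text \<open>A generator is needed twice: to build a character that separates a given element from 1,
  and to see that a product of two nonsquares is a square.\<close>

lemma mult_group_cyclic: "\<exists>g :: 'a :: {field, finite}. g \<noteq> 0 \<and> (\<forall>x. x \<noteq> 0 \<longrightarrow> (\<exists>i. x = g ^ i))"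
proof -
  let ?R = "ring_of_type_algebra :: 'a ring"
  interpret R: Ring.field ?R by (rule field_from_type_algebra)
  have pow: "x [^]\<^bsub>?R\<^esub> i = x ^ i" for x and i :: nat
    by (induction i) (simp_all add: ring_of_type_algebra_def R.nat_pow_0)
  have "finite (carrier ?R)" by simp
  then obtain g where g: "g \<in> carrier (Multiplicative_Group.mult_of ?R)"
      "carrier (Multiplicative_Group.mult_of ?R) = {g [^]\<^bsub>?R\<^esub> i | i :: nat. i \<in> UNIV}"
    by (elim R.finite_field_mult_group_has_gen [THEN bexE]) (rule that)
  have "carrier (Multiplicative_Group.mult_of ?R) = UNIV - {0}"
    by (simp add: ring_of_type_algebra_def)
  with g(2) have all: "UNIV - {0} = {g ^ i | i. i \<in> (UNIV :: nat set)}"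
    by (simp only: pow)
  have "g \<noteq> 0" using g(1) by (simp add: ring_of_type_algebra_def)
  moreover have "\<exists>i. x = g ^ i" if "x \<noteq> 0" for x
  proof -
    have "x \<in> {g ^ i | i. i \<in> (UNIV :: nat set)}" unfolding all [symmetric] using that by simp
    then show ?thesis by blast
  qed
  ultimately show ?thesis by blast
qed

lemma generator_bij_betw:
  fixes g :: "'a :: {field, finite}"
  assumes "g \<noteq> 0" "\<And>x. x \<noteq> 0 \<Longrightarrow> \<exists>i. x = g ^ i"
  shows "bij_betw (\<lambda>i. g ^ i) {..<CARD('a) - 1} (UNIV - {0})"
proof -
  let ?N = "CARD('a) - 1"
  have "1 < CARD('a)" using card_mono [of "UNIV :: 'a set" "{0, 1}"] by simp
  then have N: "?N > 0" by simp
  have red: "g ^ (i mod ?N) = g ^ i" for i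
  proof -
    have "g ^ i = g ^ (i mod ?N) * (g ^ ?N) ^ (i div ?N)"
      by (simp flip: power_add power_mult)
    then show ?thesis
      by (simp only: power_card_minus_one [OF assms(1)] power_one mult_1_right)
  qed
  have im: "(\<lambda>i. g ^ i) ` {..<?N} = UNIV - {0}"
  proof
    show "UNIV - {0} \<subseteq> (\<lambda>i. g ^ i) ` {..<?N}"
    proof
      fix x :: 'a assume "x \<in> UNIV - {0}"
      then obtain i where "x = g ^ i" using assms(2) by auto
      then show "x \<in> (\<lambda>i. g ^ i) ` {..<?N}"
        using red [of i] N by (intro image_eqI [of _ _ "i mod ?N"]) auto
    qed
  qed (use assms(1) in auto)
  moreover have "card (UNIV - {0 :: 'a}) = card {..<?N}"
    by (simp add: card_Diff_singleton)
  ultimately show ?thesis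
    by (metis bij_betw_def eq_card_imp_inj_on finite_lessThan)
qed

text \<open>The character sends g^i to w^i, where \<open>w\<close> is a primitive root of unity of
  order q - 1. It is injective on units, so it separates every \<open>a\<close> from 1. The discrete
  logarithm \<open>l\<close> is an arbitrary choice; \<open>wg\<close> shows that the value does not
  depend on it.\<close>

lemma separating_char:
  fixes a :: "'a :: {field, finite}"
  assumes "a \<noteq> 0" "a \<noteq> 1"
  shows "\<exists>\<chi>. mult_char \<chi> \<and> \<chi> a \<noteq> 1"
proof -
  obtain g :: 'a where g: "g \<noteq> 0" "\<And>x. x \<noteq> 0 \<Longrightarrow> \<exists>i. x = g ^ i"
    using mult_group_cyclic by blast
  define N where "N = CARD('a) - 1"
  have bij: "bij_betw (\<lambda>i. g ^ i) {..<N} (UNIV - {0})"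
    unfolding N_def by (rule generator_bij_betw) (use g in auto)
  have N: "N > 0"
    using card_mono [of "UNIV :: 'a set" "{0, 1}"] by (simp add: N_def)
  define w where "w = cis (2 * pi / N)"
  have wk: "w ^ k = cis (2 * pi * k / N)" for k
    by (simp add: w_def DeMoivre field_simps)
  have wN: "w ^ N = 1" using N by (simp add: wk)
  have redw: "w ^ (k mod N) = w ^ k" for k
  proof -
    have "w ^ k = w ^ (k mod N) * (w ^ N) ^ (k div N)"
      by (simp flip: power_add power_mult)
    then show ?thesis by (simp only: wN power_one mult_1_right)
  qed
  have w: "N dvd k" if "w ^ k = 1" for k
  proof -
    have "inj_on (\<lambda>k. w ^ k) {..<N}"
      using bij_betw_roots_unity [OF N] by (simp add: bij_betw_def wk)
    moreover have "w ^ (k mod N) = w ^ 0" using that by (simp add: redw)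
    ultimately have "k mod N = 0" using N by (elim inj_onD) auto
    then show ?thesis by auto
  qed
  define l where "l x = (SOME i. x = g ^ i)" for x
  have l: "g ^ l x = x" if "x \<noteq> 0" for x
    using someI_ex [OF g(2) [OF that]] by (simp add: l_def)
  have gN: "g ^ N = 1" using power_card_minus_one [OF g(1)] by (simp add: N_def)
  have wg: "w ^ i = w ^ j" if "g ^ i = g ^ j" for i j
  proof -
    have redg: "g ^ (k mod N) = g ^ k" for k
    proof -
      have "g ^ k = g ^ (k mod N) * (g ^ N) ^ (k div N)"
        by (simp flip: power_add power_mult)
      then show ?thesis by (simp only: gN power_one mult_1_right)
    qed
    have "g ^ (i mod N) = g ^ (j mod N)" using that by (simp only: redg)
    then have "i mod N = j mod N"
      using bij N by (auto simp: bij_betw_def dest: inj_onD)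
    then show ?thesis using redw by metis
  qed
  define \<chi> where "\<chi> x = (if x = 0 then 0 else w ^ l x)" for x
  have "mult_char \<chi>"
    unfolding mult_char_def
  proof (intro conjI allI)
    show "\<chi> 1 = 1" using wg [of "l 1" 0] l [of 1] by (simp add: \<chi>_def)
    show "\<chi> (x * y) = \<chi> x * \<chi> y" for x y
      using wg [of "l (x * y)" "l x + l y"]
      by (simp add: \<chi>_def l power_add [of g] flip: power_add [of w])
  qed (simp add: \<chi>_def)
  moreover have "\<chi> a \<noteq> 1"
  proof
    assume "\<chi> a = 1"
    then have "N dvd l a" using assms by (intro w) (simp add: \<chi>_def)
    then have "g ^ l a = 1" by (metis dvd_def gN power_mult power_one)
    then show False using assms l by simp
  qed
  ultimately show ?thesis by blast
qed

text \<open>Away from 0 and 1, multiplying all characters by one that separates \<open>a\<close>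
  from 1 permutes them and scales the sum. The value at 1, which is the number of characters, comes
  from double counting: summing \<chi>(x) over all pairs, only the trivial character survives in one
  order and only x = 1 in the other.\<close>

lemma sum_over_chars:
  fixes a :: "'a :: {field, finite}"
  shows "(\<Sum>\<chi> | mult_char \<chi>. \<chi> a) = (if a = 1 then of_nat CARD('a) - 1 else 0)"
proof -
  let ?X = "{\<chi> :: 'a \<Rightarrow> complex. mult_char \<chi>}"
  have vanish: "(\<Sum>\<chi> \<in> ?X. \<chi> b) = 0" if "b \<noteq> 0" "b \<noteq> 1" for b
  proof -
    obtain \<psi> :: "'a \<Rightarrow> complex" where \<psi>: "mult_char \<psi>" "\<psi> b \<noteq> 1"
      using separating_char \<open>b \<noteq> 0\<close> \<open>b \<noteq> 1\<close> by blast
    let ?\<psi>' = "\<psi> ^\<^sub>c (-1)"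
    have cancel: "\<psi> \<cdot>\<^sub>c (?\<psi>' \<cdot>\<^sub>c \<chi>) = \<chi>" "?\<psi>' \<cdot>\<^sub>c (\<psi> \<cdot>\<^sub>c \<chi>) = \<chi>" if "mult_char \<chi>" for \<chi>
      using \<psi>(1) that
      by (auto simp: fun_eq_iff char_mult_def char_pow_def char_zero char_eq_0_iff)
    have "(\<Sum>\<chi> \<in> ?X. \<chi> b) = (\<Sum>\<chi> \<in> ?X. (\<psi> \<cdot>\<^sub>c \<chi>) b)"
      by (rule sum.reindex_bij_witness
          [of _ "\<lambda>\<chi>. \<psi> \<cdot>\<^sub>c \<chi>" "\<lambda>\<chi>. ?\<psi>' \<cdot>\<^sub>c \<chi>"])
        (use \<psi>(1) in \<open>auto simp: cancel intro!: mult_char_char_mult mult_char_char_pow\<close>)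
    also have "\<dots> = \<psi> b * (\<Sum>\<chi> \<in> ?X. \<chi> b)"
      by (simp add: char_mult_def sum_distrib_left)
    finally show ?thesis using \<psi>(2) by auto
  qed
  have "(\<Sum>\<chi> \<in> ?X. \<Sum>x\<in>UNIV. \<chi> x) = (\<Sum>\<chi> \<in> {trivial_char :: 'a \<Rightarrow> complex}. \<Sum>x\<in>UNIV. \<chi> x)"
    by (intro sum.mono_neutral_right)
      (auto simp: finite_mult_char mult_char_trivial sum_nontrivial_char)
  then have "(\<Sum>x\<in>UNIV. \<Sum>\<chi> \<in> ?X. \<chi> x) = of_nat CARD('a) - 1"
    by (subst sum.swap) (simp add: sum_trivial_char)
  also have "(\<Sum>x\<in>UNIV. \<Sum>\<chi> \<in> ?X. \<chi> x) = (\<Sum>x\<in>{1}. \<Sum>\<chi> \<in> ?X. \<chi> x)"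
  proof (rule sum.mono_neutral_right)
    show "\<forall>x\<in>UNIV - {1}. (\<Sum>\<chi> \<in> ?X. \<chi> x) = 0"
      using vanish by (metis (mono_tags, lifting) DiffE char_zero insertCI mem_Collect_eq sum.neutral)
  qed auto
  finally show ?thesis using vanish
    by (cases "a = 0") (auto simp: char_zero intro!: sum.neutral)
qed

text \<open>A Moebius map is a bijection of the field only after removing its pole \<open>a\<close>
  and its value at infinity \<open>b\<close>. The two removed summands have to vanish.\<close>

lemma sum_reindex_punctured:
  fixes g h :: "'a :: finite \<Rightarrow> complex"
  assumes "\<And>x. x \<noteq> a \<Longrightarrow> j x \<noteq> b" "\<And>x. x \<noteq> a \<Longrightarrow> i (j x) = x"
    and "\<And>y. y \<noteq> b \<Longrightarrow> i y \<noteq> a" "\<And>y. y \<noteq> b \<Longrightarrow> j (i y) = y"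
    and "\<And>x. x \<noteq> a \<Longrightarrow> h (j x) = g x" and "g a = 0" "h b = 0"
  shows "(\<Sum>x\<in>UNIV. g x) = (\<Sum>y\<in>UNIV. h y)"
proof -
  have "(\<Sum>x\<in>UNIV. g x) = (\<Sum>x\<in>UNIV - {a}. g x)"
    by (rule sum.mono_neutral_right) (use assms(6) in auto)
  also have "\<dots> = (\<Sum>y\<in>UNIV - {b}. h y)"
    by (rule sum.reindex_bij_witness [of _ i j]) (use assms(1-5) in auto)
  also have "\<dots> = (\<Sum>y\<in>UNIV. h y)"
    by (rule sum.mono_neutral_left) (use assms(7) in auto)
  finally show ?thesis .
qed

text \<open>
  With \<open>t = y / (y - 1)\<close>, orthogonality of characters collapses the defining triple sum over
  \<open>\<chi>, y, z\<close> to the curve \<open>x y z = (1 - y) (1 - z)\<close>. Since \<open>u / 0 = 0\<close> and characters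
  vanish at \<open>0\<close>, no points have to be excluded from the summation over \<open>t\<close>.
\<close>

lemma gauss_2F1_eq_sum:
  fixes A B C :: "'a :: {field, finite} \<Rightarrow> complex"
  assumes A: "mult_char A" and B: "mult_char B" and C: "mult_char C" and x: "x \<noteq> 0"
  shows "gauss_2F1 A B C x = B (-1) * C (-1) / of_nat CARD('a) *
           (\<Sum>t\<in>UNIV. B (t / (1 - t)) * C (1 - t) * A (1 / (1 - x * t)))"
proof -
  define q :: complex where "q = of_nat CARD('a)"
  have "1 < CARD('a)" using card_mono [of "UNIV :: 'a set" "{0, 1}"] by simp
  then have q: "q \<noteq> 0" "q - 1 \<noteq> 0" by (auto simp: q_def)
  \<comment> \<open>The three arguments of \<chi>, collected so that orthogonality picks out the
    points where their product is 1.\<close>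
  define w where "w y z = z * y * x / ((1 - z) * (1 - y))" for y z
  define f where "f y z = B y * C (inverse (1 - y)) * A z" for y z
  define P where "P y z \<longleftrightarrow> w y z = 1" for y z
  have expand: "char_binom (A \<cdot>\<^sub>c \<chi>) \<chi> * char_binom (B \<cdot>\<^sub>c \<chi>) (C \<cdot>\<^sub>c \<chi>) * \<chi> x
      = C (-1) / q ^ 2 * (\<Sum>y\<in>UNIV. \<Sum>z\<in>UNIV. f y z * \<chi> (w y z))"
    if \<chi>: "mult_char \<chi>" for \<chi>
  proof -
    have J1: "jacobi_sum (A \<cdot>\<^sub>c \<chi>) (\<chi> ^\<^sub>c (-1)) = (\<Sum>z\<in>UNIV. A z * \<chi> (z / (1 - z)))"
      unfolding jacobi_sum_def
      by (intro sum.cong refl)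
        (simp add: char_mult_def char_pow_minus_one \<chi> char_simps divide_inverse)
    have J2: "jacobi_sum (B \<cdot>\<^sub>c \<chi>) ((C \<cdot>\<^sub>c \<chi>) ^\<^sub>c (-1))
        = (\<Sum>y\<in>UNIV. B y * C (inverse (1 - y)) * \<chi> (y / (1 - y)))"
      unfolding jacobi_sum_def
      by (intro sum.cong refl)
        (simp add: char_pow_minus_one mult_char_char_mult \<chi> C,
         simp add: char_mult_def \<chi> char_simps divide_inverse)
    have w: "\<chi> (w y z) = \<chi> x * \<chi> (z / (1 - z)) * \<chi> (y / (1 - y))" for y z
      unfolding w_def using \<chi> by (simp add: char_simps)
    have "char_binom (A \<cdot>\<^sub>c \<chi>) \<chi> * char_binom (B \<cdot>\<^sub>c \<chi>) (C \<cdot>\<^sub>c \<chi>) * \<chi> x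
        = C (-1) * (\<chi> (-1) * \<chi> (-1)) / q ^ 2 *
          ((\<Sum>y\<in>UNIV. B y * C (inverse (1 - y)) * \<chi> (y / (1 - y))) *
           (\<Sum>z\<in>UNIV. A z * \<chi> (z / (1 - z))) * \<chi> x)"
      unfolding char_binom_def J1 J2 by (simp add: char_mult_def q_def power2_eq_square)
    also have "\<dots> = C (-1) / q ^ 2 * (\<Sum>y\<in>UNIV. \<Sum>z\<in>UNIV. f y z * \<chi> (w y z))"
    proof -
      have "(\<Sum>y\<in>UNIV. B y * C (inverse (1 - y)) * \<chi> (y / (1 - y))) *
           (\<Sum>z\<in>UNIV. A z * \<chi> (z / (1 - z))) * \<chi> x = (\<Sum>y\<in>UNIV. \<Sum>z\<in>UNIV. f y z * \<chi> (w y z))"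
        unfolding sum_product unfolding sum_distrib_right w f_def
        by (intro sum.cong refl) (simp only: mult_ac)
      then show ?thesis by (simp only: char_minus_one_mult_self [OF \<chi>] mult_1_right)
    qed
    finally show ?thesis .
  qed
  have "gauss_2F1 A B C x
      = q / (q - 1) * (C (-1) / q ^ 2 * (\<Sum>\<chi> | mult_char \<chi>. \<Sum>y\<in>UNIV. \<Sum>z\<in>UNIV. f y z * \<chi> (w y z)))"
    unfolding gauss_2F1_def q_def [symmetric] by (simp add: expand sum_distrib_left)
  also have "(\<Sum>\<chi> | mult_char \<chi>. \<Sum>y\<in>UNIV. \<Sum>z\<in>UNIV. f y z * \<chi> (w y z))
      = (\<Sum>y\<in>UNIV. \<Sum>z\<in>UNIV. f y z * (\<Sum>\<chi> | mult_char \<chi>. \<chi> (w y z)))"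
    by (subst sum.swap, rule sum.cong [OF refl], subst sum.swap) (simp add: sum_distrib_left)
  also have "\<dots> = (q - 1) * (\<Sum>y\<in>UNIV. \<Sum>z\<in>UNIV. if P y z then f y z else 0)"
    unfolding sum_over_chars sum_distrib_left q_def P_def
    by (intro sum.cong refl) simp
  also have "q / (q - 1) * (C (-1) / q ^ 2 * \<dots>)
      = C (-1) / q * (\<Sum>y\<in>UNIV. \<Sum>z\<in>UNIV. if P y z then f y z else 0)"
    using q by (simp add: field_simps power2_eq_square)
  also have "(\<Sum>y\<in>UNIV. \<Sum>z\<in>UNIV. if P y z then f y z else 0)
      = (\<Sum>y\<in>UNIV. f y ((1 - y) / (1 - y + x * y)))"
  proof (rule sum.cong [OF refl])
    fix y :: 'a
    define d where "d = 1 - y + x * y"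
    consider "y = 0 \<or> y = 1" | "y \<noteq> 0" "y \<noteq> 1" "d = 0" | "y \<noteq> 0" "y \<noteq> 1" "d \<noteq> 0" by blast
    then show "(\<Sum>z\<in>UNIV. if P y z then f y z else 0) = f y ((1 - y) / (1 - y + x * y))"
    proof cases
      case 1
      then have "f y z = 0" for z by (auto simp: f_def char_zero B C)
      then show ?thesis by (simp cong: if_cong)
    next
      case 2
      \<comment> \<open>The curve has no point over this \<open>y\<close>. On the other side the
        division by \<open>d\<close> = 0 yields A 0 = 0, so the formula still holds.\<close>
      have "\<not> P y z" for z
      proof
        assume "P y z"
        then have "z \<noteq> 1" "z * y * x = (1 - z) * (1 - y)"
          using 2 by (auto simp: P_def w_def divide_simps split: if_splits)
        then have "z * d = 1 - y" by (simp add: d_def algebra_simps)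
        then show False using 2 by simp
      qed
      then show ?thesis using 2(3) by (simp add: f_def d_def char_zero A)
    next
      case 3
      have P: "P y z \<longleftrightarrow> z = (1 - y) / d" for z
      proof
        assume "P y z"
        then have "z \<noteq> 1" "z * y * x = (1 - z) * (1 - y)"
          using 3 by (auto simp: P_def w_def divide_simps split: if_splits)
        then have "z * d = 1 - y" by (simp add: d_def algebra_simps)
        then show "z = (1 - y) / d" using 3 by (simp add: field_simps)
      next
        assume z: "z = (1 - y) / d"
        have "1 - z = x * y / d" using 3(3) by (simp add: z field_simps) (simp add: d_def)
        then show "P y z" using 3 x by (simp add: P_def w_def z)
      qed
      show ?thesis by (simp add: P flip: d_def)
    qed
  qed
  \<comment> \<open>Under this substitution t / (1 - t) = -y, which is the origin of the factor B
    (-1).\<close>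
  also have "\<dots> = (\<Sum>t\<in>UNIV. B (-1) * (B (t / (1 - t)) * C (1 - t) * A (1 / (1 - x * t))))"
  proof (rule sum_reindex_punctured
      [where a = 1 and b = 1 and i = "\<lambda>t. t / (t - 1)" and j = "\<lambda>y. y / (y - 1)"])
    fix y :: 'a assume "y \<noteq> 1"
    then have y: "y - 1 \<noteq> 0" "1 - y \<noteq> 0" by auto
    define t where "t = y / (y - 1)"
    have t: "1 - t = 1 / (1 - y)" "t / (1 - t) = - y" using y by (simp_all add: t_def field_simps)
    have "1 - x * t = (1 - y + x * y) / (1 - y)" using y by (simp add: t_def field_simps)
    then have "f y ((1 - y) / (1 - y + x * y)) = B y * C (1 - t) * A (1 / (1 - x * t))"
      by (simp add: f_def t(1) inverse_eq_divide)
    also have "B y = B (-1) * B (t / (1 - t))"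
      using char_uminus [OF B, of y] char_minus_one_mult_self [OF B]
      by (simp add: t(2) flip: mult.assoc)
    finally show "B (-1) * (B (y / (y - 1) / (1 - y / (y - 1))) * C (1 - y / (y - 1)) *
        A (1 / (1 - x * (y / (y - 1))))) = f y ((1 - y) / (1 - y + x * y))"
      by (simp add: t_def)
  qed (auto simp: f_def char_zero B C field_simps)
  finally show ?thesis by (simp add: q_def sum_distrib_left mult_ac)
qed

section \<open>Jacobi sums\<close>

lemma jacobi_sum_commute: "jacobi_sum A B = jacobi_sum B A"
  unfolding jacobi_sum_def
  by (rule sum.reindex_bij_witness [of _ "\<lambda>x. 1 - x" "\<lambda>x. 1 - x"]) auto

text \<open>The map x / (x - 1) fixes 0 and exchanges 1 with infinity, so the character at 1 is
  replaced by the one at infinity, which is the inverse of the product.\<close>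

lemma jacobi_sum_inverse:
  fixes A B :: "'a :: {field, finite} \<Rightarrow> complex"
  assumes A: "mult_char A" and B: "mult_char B"
  shows "jacobi_sum A B = A (-1) * jacobi_sum A ((A \<cdot>\<^sub>c B) ^\<^sub>c (-1))"
  unfolding jacobi_sum_def sum_distrib_left
proof (rule sum_reindex_punctured
    [where a = 1 and b = 1 and i = "\<lambda>t. t / (t - 1)" and j = "\<lambda>y. y / (y - 1)"])
  fix x :: 'a assume "x \<noteq> 1"
  then have x: "x - 1 \<noteq> 0" "1 - x \<noteq> 0" by auto
  define t where "t = x / (x - 1)"
  have t: "1 - t = 1 / (1 - x)" using x by (simp add: t_def field_simps)
  have "x = - t * (1 - x)" using x by (simp add: t_def field_simps)
  then have "A x = A (-1) * A t * A (1 - x)"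
    using A by (metis char_times char_uminus)
  then show "A (-1) * (A (x / (x - 1)) * ((A \<cdot>\<^sub>c B) ^\<^sub>c (-1)) (1 - x / (x - 1))) = A x * B (1 - x)"
    unfolding t_def [symmetric]
    by (simp add: char_pow_minus_one mult_char_char_mult A B t) (simp add: char_mult_def)
qed (use A B in \<open>auto simp: char_zero char_pow_def field_simps\<close>)

text \<open>Scaling by \<open>w\<close> works for nonzero \<open>w\<close>. At w = 0 the left side
  is a multiple of the sum of the product character, and it agrees with the right side, which is 0,
  exactly because that character is nontrivial.\<close>

lemma sum_char_convolution:
  assumes A: "mult_char A" and B: "mult_char B" and "w \<noteq> 0 \<or> A \<cdot>\<^sub>c B \<noteq> trivial_char"
  shows "(\<Sum>x\<in>UNIV. A x * B (w - x)) = A w * B w * jacobi_sum A B"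
proof (cases "w = 0")
  case True
  have "(\<Sum>x\<in>UNIV. A x * B (w - x)) = B (-1) * (\<Sum>x\<in>UNIV. (A \<cdot>\<^sub>c B) x)"
    unfolding sum_distrib_left
  proof (rule sum.cong [OF refl])
    fix x
    show "A x * B (w - x) = B (- 1) * (A \<cdot>\<^sub>c B) x"
      using True char_uminus [OF B, of x] by (simp add: char_mult_def)
  qed
  then show ?thesis
    using True assms by (simp add: sum_nontrivial_char mult_char_char_mult char_zero)
next
  case False
  have "(\<Sum>x\<in>UNIV. A x * B (w - x)) = (\<Sum>x\<in>UNIV. A (w * x) * B (w - w * x))"
    by (rule sum.reindex_bij_witness [of _ "\<lambda>x. w * x" "\<lambda>x. x / w"]) (use False in auto)
  also have "\<dots> = (\<Sum>x\<in>UNIV. A w * B w * (A x * B (1 - x)))"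
  proof (rule sum.cong [OF refl])
    fix x
    have "w - w * x = w * (1 - x)" by (simp add: algebra_simps)
    then show "A (w * x) * B (w - w * x) = A w * B w * (A x * B (1 - x))"
      by (simp only: char_times [OF A] char_times [OF B] mult_ac)
  qed
  finally show ?thesis by (simp add: jacobi_sum_def sum_distrib_left)
qed

text \<open>Written out, the product is the double sum of A(x) B(w - x) C(1 - w); the substitution v
  = 1 + x - w exchanges the arguments of \<open>B\<close> and \<open>C\<close>.\<close>

lemma jacobi_sum_mult:
  assumes A: "mult_char A" and B: "mult_char B" and AB: "A \<cdot>\<^sub>c B \<noteq> trivial_char"
  shows "jacobi_sum A B * jacobi_sum (A \<cdot>\<^sub>c B) C
    = (\<Sum>v\<in>UNIV. B (1 - v) * (\<Sum>x\<in>UNIV. A x * C (v - x)))"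
proof -
  have "jacobi_sum A B * jacobi_sum (A \<cdot>\<^sub>c B) C
      = (\<Sum>w\<in>UNIV. (\<Sum>x\<in>UNIV. A x * B (w - x)) * C (1 - w))"
    using sum_char_convolution [OF A B] AB
    by (simp add: jacobi_sum_def [of "A \<cdot>\<^sub>c B"] char_mult_def sum_distrib_left mult_ac)
  also have "\<dots> = (\<Sum>x\<in>UNIV. \<Sum>w\<in>UNIV. A x * B (w - x) * C (1 - w))"
    unfolding sum_distrib_right by (rule sum.swap)
  also have "\<dots> = (\<Sum>x\<in>UNIV. \<Sum>v\<in>UNIV. A x * B (1 - v) * C (v - x))"
  proof (rule sum.cong [OF refl])
    fix x
    show "(\<Sum>w\<in>UNIV. A x * B (w - x) * C (1 - w)) = (\<Sum>v\<in>UNIV. A x * B (1 - v) * C (v - x))"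
      by (rule sum.reindex_bij_witness [of _ "\<lambda>v. 1 + x - v" "\<lambda>v. 1 + x - v"])
        (simp_all add: algebra_simps)
  qed
  also have "\<dots> = (\<Sum>v\<in>UNIV. B (1 - v) * (\<Sum>x\<in>UNIV. A x * C (v - x)))"
    by (subst sum.swap) (simp add: sum_distrib_left mult_ac)
  finally show ?thesis .
qed

text \<open>Both sides are the same double sum, read with \<open>B\<close> and \<open>C\<close>
  exchanged. This replaces the symmetry of the Gauss sum quotient g(A) g(B) g(C) / g(ABC).\<close>

lemma jacobi_sum_exchange:
  assumes A: "mult_char A" and B: "mult_char B" and C: "mult_char C"
    and AB: "A \<cdot>\<^sub>c B \<noteq> trivial_char" and AC: "A \<cdot>\<^sub>c C \<noteq> trivial_char"
  shows "jacobi_sum A B * jacobi_sum (A \<cdot>\<^sub>c B) C = jacobi_sum A C * jacobi_sum (A \<cdot>\<^sub>c C) B"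
  using sum_char_convolution [OF A C] AC
  by (simp add: jacobi_sum_mult [OF A B AB] jacobi_sum_def [of "A \<cdot>\<^sub>c C"] char_mult_def
      sum_distrib_left mult_ac)

lemma jacobi_sum_inverse_self:
  fixes A :: "'a :: {field, finite} \<Rightarrow> complex"
  assumes A: "mult_char A" "A \<noteq> trivial_char"
  shows "jacobi_sum A (A ^\<^sub>c (-1)) = - A (-1)"
proof -
  have "jacobi_sum A (A ^\<^sub>c (-1)) = (\<Sum>x\<in>UNIV. A (x / (1 - x)))"
    using A by (simp add: jacobi_sum_def char_pow_minus_one char_simps divide_inverse)
  \<comment> \<open>The value -1 is the image of infinity under x / (1 - x), so it is the only one
    missed.\<close>
  also have "\<dots> = (\<Sum>u\<in>UNIV - {-1}. A u)"
  proof (rule sum.reindex_bij_witness_not_neutral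
        [of "{1}" "{}" _ "\<lambda>u. u / (1 + u)" "\<lambda>x. x / (1 - x)"])
    fix u :: 'a assume "u \<in> UNIV - {- 1} - {}"
    then have u: "1 + u \<noteq> 0" by (simp add: add_eq_0_iff)
    then have "1 - u / (1 + u) = 1 / (1 + u)" by (simp add: field_simps)
    then show "u / (1 + u) / (1 - u / (1 + u)) = u" "u / (1 + u) \<in> UNIV - {1}"
      using u by auto
  qed (use A in \<open>auto simp: field_simps char_zero\<close>)
  also have "\<dots> = (\<Sum>u\<in>UNIV. A u) - A (-1)"
    by (simp add: sum_diff1)
  finally show ?thesis using sum_nontrivial_char A by simp
qed

text \<open>When the product of the characters is nontrivial, J(A, B) J(AB, A^(-1)) = A(-1) q: the
  inner convolution of \<open>A\<close> with its inverse is constant apart from a jump of A(-1) q at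
  0, and the constant part is killed by the vanishing sum of \<open>B\<close>.\<close>

lemma jacobi_sum_nonzero:
  fixes A B :: "'a :: {field, finite} \<Rightarrow> complex"
  assumes A: "mult_char A" "A \<noteq> trivial_char" and B: "mult_char B" "B \<noteq> trivial_char"
  shows "jacobi_sum A B \<noteq> 0"
proof (cases "A \<cdot>\<^sub>c B = trivial_char")
  case True
  have "B = A ^\<^sub>c (-1)"
  proof
    fix x
    show "B x = (A ^\<^sub>c (-1)) x"
      using B fun_cong [OF True, of x] inverse_unique [of "A x" "B x"]
      by (auto simp: char_pow_def char_mult_def trivial_char_def char_zero split: if_splits)
  qed
  then show ?thesis using jacobi_sum_inverse_self [OF A] A by (simp add: char_eq_0_iff)
next
  case False
  let ?A' = "A ^\<^sub>c (-1)" and ?q = "of_nat CARD('a) :: complex"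
  have A': "mult_char ?A'" using A by (simp add: mult_char_char_pow)
  have AA: "A x * ?A' x = trivial_char x" for x
    using A by (simp add: char_pow_def trivial_char_def char_eq_0_iff)
  have inner: "(\<Sum>x\<in>UNIV. A x * ?A' (v - x)) = (if v = 0 then A (-1) * ?q else 0) - A (-1)" for v
  proof (cases "v = 0")
    case True
    have "A x * ?A' (- x) = A (-1) * trivial_char x" for x
      using char_uminus [OF A', of x] AA [of x] A
      by (simp add: char_pow_minus_one [OF A(1), of "-1"])
    then have "(\<Sum>x\<in>UNIV. A x * ?A' (v - x)) = A (-1) * (\<Sum>x\<in>UNIV. trivial_char (x :: 'a))"
      using True by (simp add: sum_distrib_left)
    then show ?thesis using True
      by (simp add: sum_trivial_char algebra_simps)
  next
    case False
    then show ?thesis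
      using sum_char_convolution [OF A(1) A', of v] jacobi_sum_inverse_self [OF A] AA [of v]
      by (simp add: trivial_char_def)
  qed
  have "jacobi_sum A B * jacobi_sum (A \<cdot>\<^sub>c B) ?A'
      = (\<Sum>v\<in>UNIV. (if v = 0 then A (-1) * ?q else 0) - A (-1) * B (1 - v))"
    unfolding jacobi_sum_mult [OF A(1) B(1) False] inner
    by (intro sum.cong refl) (simp add: B char_one algebra_simps)
  also have "(\<Sum>v\<in>UNIV. A (-1) * B (1 - v)) = A (-1) * (\<Sum>v\<in>UNIV. B v)"
    unfolding sum_distrib_left
    by (rule sum.reindex_bij_witness [of _ "\<lambda>v. 1 - v" "\<lambda>v. 1 - v"]) auto
  then have "(\<Sum>v\<in>UNIV. (if v = 0 then A (-1) * ?q else 0) - A (-1) * B (1 - v)) = A (-1) * ?q"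
    using B by (simp add: sum_subtractf sum_nontrivial_char)
  finally have "jacobi_sum A B * jacobi_sum (A \<cdot>\<^sub>c B) ?A' = A (-1) * ?q" .
  then show ?thesis using A by (auto simp: char_eq_0_iff)
qed

section \<open>The quadratic character\<close>

text \<open>The case with content is that of two nonsquares: they are odd powers of a generator, so
  their product is an even power.\<close>

lemma mult_char_quad: "mult_char (quad_char :: 'a :: {field, finite} \<Rightarrow> complex)"
proof -
  obtain g :: 'a where g: "g \<noteq> 0" "\<And>x. x \<noteq> 0 \<Longrightarrow> \<exists>i. x = g ^ i"
    using mult_group_cyclic by blast
  have nonsq: "\<exists>z. x * y = z ^ 2"
    if xy: "x \<noteq> 0" "y \<noteq> 0" "\<nexists>z. x = z ^ 2" "\<nexists>z. y = z ^ 2" for x y :: 'a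
  proof -
    obtain i j where ij: "x = g ^ i" "y = g ^ j" using g(2) xy(1,2) by blast
    have "odd i" "odd j" using xy(3,4) unfolding ij
      by (metis evenE mult.commute power_mult)+
    then have "even (i + j)" by simp
    then show ?thesis unfolding ij by (metis evenE mult.commute power_add power_mult)
  qed
  have sq: "(\<exists>z. x * y = z ^ 2) \<longleftrightarrow> (\<exists>z. y = z ^ 2)" if x: "x \<noteq> 0" "\<exists>z. x = z ^ 2" for x y :: 'a
  proof -
    obtain a where a: "x = a ^ 2" using x by blast
    show ?thesis
    proof
      assume "\<exists>z. x * y = z ^ 2"
      then obtain b where "x * y = b ^ 2" by blast
      then have "y = (b / a) ^ 2" using a x(1) by (simp add: field_simps power_divide)
      then show "\<exists>z. y = z ^ 2" by blast
    next
      assume "\<exists>z. y = z ^ 2"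
      then show "\<exists>z. x * y = z ^ 2" using a by (metis power_mult_distrib)
    qed
  qed
  have "quad_char (x * y) = quad_char x * quad_char y" for x y :: 'a
  proof (cases "x = 0 \<or> y = 0")
    case True
    then show ?thesis by (auto simp: quad_char_def)
  next
    case False
    then show ?thesis
      using nonsq [of x y] sq [of x y] sq [of y x]
      by (auto simp: quad_char_def mult.commute)
  qed
  moreover have "quad_char (1 :: 'a) = 1"
    using power_one [of 2] by (metis quad_char_def zero_neq_one)
  ultimately show ?thesis by (simp add: mult_char_def quad_char_def)
qed

lemmas quad_char_simps = char_simps [OF mult_char_quad]

lemma quad_char_square: "x \<noteq> 0 \<Longrightarrow> quad_char (x ^ 2) = 1"
  by (auto simp: quad_char_def)

lemma quad_char_mult_self: "x \<noteq> 0 \<Longrightarrow> quad_char x * quad_char x = 1"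
  using quad_char_square [of x] by (simp add: quad_char_simps power2_eq_square)

lemma inverse_quad_char: "inverse (quad_char x) = quad_char x"
  by (simp add: quad_char_def)

text \<open>If every element were a square, squaring would be surjective, hence injective on a
  finite field, although 1 and -1 have the same square.\<close>

lemma quad_char_nontrivial:
  assumes "(2 :: 'a :: {field, finite}) \<noteq> 0"
  shows "(quad_char :: 'a \<Rightarrow> complex) \<noteq> trivial_char"
proof
  assume eq: "(quad_char :: 'a \<Rightarrow> complex) = trivial_char"
  have "surj (\<lambda>y :: 'a. y ^ 2)"
  unfolding surj_def
  proof
    fix x :: 'a
    show "\<exists>y. x = y ^ 2"
      using fun_cong [OF eq, of x]
      by (cases "x = 0") (auto simp: quad_char_def trivial_char_def split: if_splits intro: exI [of _ 0])
  qed
  then have "inj (\<lambda>y :: 'a. y ^ 2)" by (simp add: finite_UNIV_surj_inj)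
  from injD [OF this, of 1 "-1"] have "(1 :: 'a) = - 1" by simp
  then have "(1 :: 'a) + 1 = 0" by (simp only: eq_neg_iff_add_eq_0)
  then show False using assms by simp
qed

section \<open>Square roots, and the map from t to t + 1/t\<close>

lemma square_roots_square:
  fixes r :: "'a :: field" shows "{s. s ^ 2 = r ^ 2} = {r, - r}"
  by (auto simp: power2_eq_iff)

lemma minus_neq_self:
  fixes r :: "'a :: field"
  assumes "(2 :: 'a) \<noteq> 0" "r \<noteq> 0" shows "- r \<noteq> r"
proof
  assume eq: "- r = r"
  have "2 * r = - r + r" by (simp only: eq mult_2)
  then have "2 * r = 0" by simp
  then show False using assms by simp
qed

lemma card_square_roots:
  fixes x :: "'a :: {field, finite}"
  assumes "(2 :: 'a) \<noteq> 0"
  shows "of_nat (card {r. r ^ 2 = x}) = 1 + quad_char x"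
proof (cases "\<exists>r. x = r ^ 2")
  case True
  then obtain r where r: "x = r ^ 2" by blast
  show ?thesis
  proof (cases "r = 0")
    case True
    then show ?thesis using r by (simp add: quad_char_def)
  next
    case False
    then show ?thesis unfolding r square_roots_square
      using minus_neq_self [OF assms False] by (simp add: quad_char_square)
  qed
next
  case False
  then have "{r. r ^ 2 = x} = {}" by blast
  then show ?thesis using False by (auto simp: quad_char_def)
qed

text \<open>If t + 1/t = v, then v + 2 = (t + 1)^2 / t and v - 2 = (t - 1)^2 / t, so both terms on
  the right equal \<phi>(t), and the fibre is {t, 1/t}. For t = 1 or t = -1 the fibre shrinks to one
  point and one term on the right vanishes. If the fibre is empty, v^2 - 4 is a nonsquare and the
  two terms cancel.\<close>

lemma sum_quad_char_fibre:
  fixes v :: "'a :: {field, finite}"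
  assumes two: "(2 :: 'a) \<noteq> 0"
  shows "(\<Sum>t | t \<noteq> 0 \<and> t + inverse t = v. quad_char t) = quad_char (v + 2) + quad_char (v - 2)"
proof (cases "\<exists>t. t \<noteq> 0 \<and> t + inverse t = v")
  case True
  then obtain t where t: "t \<noteq> 0" and v: "v = t + inverse t" by blast
  have roots: "{s. s \<noteq> 0 \<and> s + inverse s = v} = {t, inverse t}"
  proof (intro antisym subsetI)
    fix s assume "s \<in> {s. s \<noteq> 0 \<and> s + inverse s = v}"
    then have s: "s \<noteq> 0" "s + inverse s = t + inverse t" by (auto simp: v)
    then have "(s - t) * (s * t - 1) = 0" using t by (simp add: field_simps)
    then have "s = t \<or> s * t = 1" by auto
    then show "s \<in> {t, inverse t}" using t s by (auto simp: field_simps)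
  qed (use t in \<open>auto simp: v add.commute\<close>)
  have plus: "quad_char (v + 2) = quad_char t * quad_char ((t + 1) ^ 2)"
  proof -
    have "v + 2 = (t + 1) ^ 2 / t" using t by (simp add: v field_simps power2_eq_square)
    then show ?thesis by (simp add: quad_char_simps divide_inverse inverse_quad_char)
  qed
  have minus: "quad_char (v - 2) = quad_char t * quad_char ((t - 1) ^ 2)"
  proof -
    have "v - 2 = (t - 1) ^ 2 / t" using t by (simp add: v field_simps power2_eq_square)
    then show ?thesis by (simp add: quad_char_simps divide_inverse inverse_quad_char)
  qed
  show ?thesis
  proof (cases "t = 1 \<or> t = -1")
    case True
    have "(1 :: 'a) + 1 \<noteq> 0" "- 1 - (1 :: 'a) \<noteq> 0"
      using two by (simp_all add: eq_neg_iff_add_eq_0 [symmetric] flip: minus_add_distrib)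
    moreover have "quad_char (4 :: 'a) = 1"
      using quad_char_square [OF two] by simp
    ultimately show ?thesis
      using True unfolding roots plus minus
      by (auto simp: quad_char_square quad_char_simps(1))
  next
    case False
    then have "t + 1 \<noteq> 0" "t - 1 \<noteq> 0" by (auto simp: add_eq_0_iff2)
    moreover have "inverse t \<noteq> t"
    proof
      assume "inverse t = t"
      then have "t ^ 2 = 1" using t by (metis power2_eq_square right_inverse)
      then show False using False by (simp add: power2_eq_1_iff)
    qed
    ultimately show ?thesis unfolding roots plus minus
      by (simp add: quad_char_square char_inverse [OF mult_char_quad] inverse_quad_char)
  qed
next
  case False
  then have empty: "{t. t \<noteq> 0 \<and> t + inverse t = v} = {}" by blast
  have nonsq: "\<nexists>d. (v + 2) * (v - 2) = d ^ 2"
  proof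
    assume "\<exists>d. (v + 2) * (v - 2) = d ^ 2"
    then obtain d where d: "(v + 2) * (v - 2) = d ^ 2" by blast
    define t where "t = (v + d) / 2"
    have "4 * (t ^ 2 - v * t + 1) = (2 * t) ^ 2 - 2 * v * (2 * t) + 4"
      by (simp add: algebra_simps power2_eq_square)
    also have "2 * t = v + d" using two by (simp add: t_def)
    also have "(v + d) ^ 2 - 2 * v * (v + d) + 4 = d ^ 2 - (v + 2) * (v - 2)"
      by (simp add: algebra_simps power2_eq_square)
    finally have "2 * (2 * (t ^ 2 - v * t + 1)) = 0" by (simp add: d)
    then have eq: "t ^ 2 - v * t + 1 = 0" using two by (simp only: mult_eq_0_iff) simp
    then have "t \<noteq> 0" by auto
    moreover from this have "t + inverse t = v"
      using eq by (simp add: field_simps power2_eq_square)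
    ultimately show False using False by blast
  qed
  then have "(v + 2) * (v - 2) \<noteq> 0" by (metis zero_power2)
  with nonsq have "quad_char ((v + 2) * (v - 2)) = -1"
    unfolding quad_char_def by (simp only: if_False)
  then have "quad_char (v + 2) * quad_char (v - 2) = -1"
    by (simp only: quad_char_simps)
  then show ?thesis unfolding empty
    by (auto simp: quad_char_def split: if_splits)
qed

lemma sum_quad_char_plus_inverse:
  fixes f :: "'a :: {field, finite} \<Rightarrow> complex"
  assumes "(2 :: 'a) \<noteq> 0"
  shows "(\<Sum>t\<in>UNIV. quad_char t * f (t + inverse t))
    = (\<Sum>v\<in>UNIV. (quad_char (v + 2) + quad_char (v - 2)) * f v)"
proof -
  have "(\<Sum>t\<in>UNIV. quad_char t * f (t + inverse t))
      = (\<Sum>t\<in>UNIV - {0}. quad_char t * f (t + inverse t))"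
    by (rule sum.mono_neutral_right) (auto simp: quad_char_def)
  also have "\<dots> = (\<Sum>v\<in>UNIV. \<Sum>t | t \<in> UNIV - {0} \<and> t + inverse t = v. quad_char t * f (t + inverse t))"
    by (rule sum.group [symmetric]) auto
  also have "\<dots> = (\<Sum>v\<in>UNIV. (\<Sum>t | t \<noteq> 0 \<and> t + inverse t = v. quad_char t) * f v)"
    by (auto simp: sum_distrib_right intro!: sum.cong)
  finally show ?thesis by (simp only: sum_quad_char_fibre [OF assms])
qed

text \<open>
  The finite field analogue of
  \<open>\<^sub>2F\<^sub>1(a, a + 1/2; 1/2; z) = ((1 + \<surd>z)\<^bsup>-2a\<^esup> + (1 - \<surd>z)\<^bsup>-2a\<^esup>) / 2\<close>.
\<close>

lemma sum_square_roots:
  fixes B :: "'a :: {field, finite} \<Rightarrow> complex"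
  assumes two: "(2 :: 'a) \<noteq> 0" and B: "mult_char B" and nt: "quad_char \<cdot>\<^sub>c B \<noteq> trivial_char"
  shows "(\<Sum>t\<in>UNIV. quad_char t * B ((1 - t) * (1 - x * t) / t))
    = B (-1) * jacobi_sum quad_char B * (\<Sum>r | r ^ 2 = x. B (1 - r) ^ 2)"
proof (cases "\<exists>r. x = r ^ 2")
  case False
  then have x: "x \<noteq> 0" "quad_char x = -1" by (auto simp: quad_char_def)
  let ?f = "\<lambda>t. quad_char t * B ((1 - t) * (1 - x * t) / t)"
  \<comment> \<open>The involution 1 / (x t) preserves the argument of \<open>B\<close> and changes
    the sign of \<phi>(t), because \<open>x\<close> is a nonsquare.\<close>
  have "(\<Sum>t\<in>UNIV. ?f t) = (\<Sum>t\<in>UNIV. - ?f t)"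
  proof (rule sum.reindex_bij_witness [of _ "\<lambda>t. inverse (x * t)" "\<lambda>t. inverse (x * t)"])
    fix t :: 'a
    show "- ?f (inverse (x * t)) = ?f t"
    proof (cases "t = 0")
      case False
      then have "(1 - inverse (x * t)) * (1 - x * inverse (x * t)) / inverse (x * t)
          = (1 - t) * (1 - x * t) / t"
        using x by (simp add: field_simps)
      then show ?thesis by (simp add: quad_char_simps inverse_quad_char x)
    qed (simp add: quad_char_simps)
  qed (use x in auto)
  then have "(\<Sum>t\<in>UNIV. ?f t) = 0" by (simp add: sum_negf)
  moreover have "{r. r ^ 2 = x} = {}" using False by blast
  ultimately show ?thesis by (simp only: sum.empty mult_zero_right)
next
  case True
  then obtain r where r: "x = r ^ 2" by blast
  show ?thesis
  proof (cases "r = 0")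
    case True
    have "(\<Sum>t\<in>UNIV. quad_char t * B ((1 - t) * (1 - x * t) / t))
        = (\<Sum>t\<in>UNIV. B (-1) * (quad_char t * B (1 - t)))"
    proof (rule sum.reindex_bij_witness [of _ inverse inverse])
      fix t :: 'a
      show "B (-1) * (quad_char (inverse t) * B (1 - inverse t))
          = quad_char t * B ((1 - t) * (1 - x * t) / t)"
      proof (cases "t = 0")
        case False
        then have "(1 - t) * (1 - x * t) / t = - (1 - inverse t)"
          using True r by (simp add: field_simps)
        then show ?thesis
          using char_uminus [OF B, of "1 - inverse t"]
          by (simp add: quad_char_simps inverse_quad_char)
      qed (simp add: quad_char_simps)
    qed auto
    then show ?thesis using True r B
      by (simp add: jacobi_sum_def sum_distrib_left char_one)
  next
    case False
    \<comment> \<open>To be used with c = 1 + r and c = 1 - r. When c = 0, which happens for r = 1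
      or r = -1, the convolution formula relies on \<open>nt\<close>.\<close>
    have K: "(\<Sum>w\<in>UNIV. quad_char w * B (r * w - c ^ 2))
        = quad_char r * B (-1) * B c ^ 2 * jacobi_sum quad_char B" for c
    proof -
      have eq: "quad_char w * B (r * w - c ^ 2) = B (-1) * B r * (quad_char w * B (c ^ 2 / r - w))" for w
      proof -
        have "r * w - c ^ 2 = - (r * (c ^ 2 / r - w))" using False by (simp add: field_simps)
        then show ?thesis using char_uminus [OF B, of "r * (c ^ 2 / r - w)"]
          by (simp add: char_times [OF B])
      qed
      have "(\<Sum>w\<in>UNIV. quad_char w * B (r * w - c ^ 2))
          = B (-1) * B r * (\<Sum>w\<in>UNIV. quad_char w * B (c ^ 2 / r - w))"
        by (simp only: eq sum_distrib_left)
      also have "\<dots> = B (-1) * B r * (quad_char (c ^ 2 / r) * B (c ^ 2 / r) * jacobi_sum quad_char B)"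
        using nt by (simp only: sum_char_convolution [OF mult_char_quad B] simp_thms)
      also have "\<dots> = B (-1) * quad_char (c ^ 2) * quad_char r * B c ^ 2 * jacobi_sum quad_char B"
        using False by (simp add: quad_char_simps char_simps [OF B] divide_inverse
            inverse_quad_char char_eq_0_iff [OF B])
      also have "\<dots> = quad_char r * B (-1) * B c ^ 2 * jacobi_sum quad_char B"
        by (cases "c = 0") (simp_all add: quad_char_square char_zero [OF B])
      finally show ?thesis .
    qed
    \<comment> \<open>Rescaling by \<open>r\<close> makes the argument of \<open>B\<close> invariant
      under inversion, hence a function of t + 1/t. The shifts by 2 that follow turn the constant 1
      + r^2 into (1 + r)^2 and (1 - r)^2.\<close>
    have "(\<Sum>t\<in>UNIV. quad_char t * B ((1 - t) * (1 - x * t) / t))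
        = (\<Sum>t\<in>UNIV. quad_char r * (quad_char t * B (r * (t + inverse t) - (1 + r ^ 2))))"
    proof (rule sum.reindex_bij_witness [of _ "\<lambda>t. t / r" "\<lambda>t. r * t"])
      fix t :: 'a
      show "quad_char r * (quad_char (r * t) * B (r * (r * t + inverse (r * t)) - (1 + r ^ 2)))
          = quad_char t * B ((1 - t) * (1 - x * t) / t)"
      proof (cases "t = 0")
        case 1: False
        then have "(1 - t) * (1 - x * t) / t = r * (r * t + inverse (r * t)) - (1 + r ^ 2)"
          using False r by (simp add: field_simps power2_eq_square)
        then show ?thesis using quad_char_mult_self [OF False]
          by (simp add: quad_char_simps flip: mult.assoc)
      qed (simp add: quad_char_simps)
    qed (use False in auto)
    also have "\<dots> = quad_char r * (\<Sum>v\<in>UNIV. (quad_char (v + 2) + quad_char (v - 2)) *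
        B (r * v - (1 + r ^ 2)))"
      using sum_quad_char_plus_inverse [OF two, of "\<lambda>v. B (r * v - (1 + r ^ 2))"]
      by (simp only: flip: sum_distrib_left)
    also have "\<dots> = quad_char r * ((\<Sum>v\<in>UNIV. quad_char (v + 2) * B (r * v - (1 + r ^ 2))) +
        (\<Sum>v\<in>UNIV. quad_char (v - 2) * B (r * v - (1 + r ^ 2))))"
      by (simp add: distrib_right sum.distrib)
    also have "(\<Sum>v\<in>UNIV. quad_char (v + 2) * B (r * v - (1 + r ^ 2)))
        = (\<Sum>w\<in>UNIV. quad_char w * B (r * w - (1 + r) ^ 2))"
      by (rule sum.reindex_bij_witness [of _ "\<lambda>w. w - 2" "\<lambda>v. v + 2"])
        (simp_all add: algebra_simps power2_eq_square)
    also have "(\<Sum>v\<in>UNIV. quad_char (v - 2) * B (r * v - (1 + r ^ 2)))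
        = (\<Sum>w\<in>UNIV. quad_char w * B (r * w - (1 - r) ^ 2))"
      by (rule sum.reindex_bij_witness [of _ "\<lambda>w. w + 2" "\<lambda>v. v - 2"])
        (simp_all add: algebra_simps power2_eq_square)
    also have "quad_char r * ((\<Sum>w\<in>UNIV. quad_char w * B (r * w - (1 + r) ^ 2)) +
          (\<Sum>w\<in>UNIV. quad_char w * B (r * w - (1 - r) ^ 2)))
        = (quad_char r * quad_char r) * B (-1) * jacobi_sum quad_char B * (B (1 + r) ^ 2 + B (1 - r) ^ 2)"
      unfolding K by (simp add: algebra_simps)
    also have "B (1 + r) ^ 2 + B (1 - r) ^ 2 = (\<Sum>s | s ^ 2 = x. B (1 - s) ^ 2)"
      unfolding r square_roots_square using minus_neq_self [OF two False] by simp
    finally show ?thesis using quad_char_mult_self [OF False] by simp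
  qed
qed

section \<open>The common character sum\<close>

text \<open>Moving exponents into the argument reduces identities between character powers to
  identities of field elements. The exponent 0 is excluded because x^0 = 1 even at x = 0.\<close>

lemma char_pow_of_nat:
  assumes "mult_char T" "n > 0" shows "(T ^\<^sub>c int n) x = T (x ^ n)"
  using assms by (cases "x = 0") (simp_all add: char_pow_def char_simps)

lemma char_pow_minus_of_nat:
  assumes "mult_char T" "n > 0" shows "(T ^\<^sub>c (- int n)) x = T (inverse (x ^ n))"
  using assms by (cases "x = 0") (simp_all add: char_pow_def char_simps power_int_minus)

lemmas char_pow_numeral =
  char_pow_of_nat [of _ "numeral k" for k, simplified]
  char_pow_minus_of_nat [of _ "numeral k" for k, simplified]
  char_pow_minus_one

lemma eq_trivial_charI:
  assumes "mult_char \<chi>" "\<And>x. x \<noteq> 0 \<Longrightarrow> \<chi> x = 1" shows "\<chi> = trivial_char"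
  using assms by (auto simp: fun_eq_iff trivial_char_def char_zero)

lemma trivial_charD: "\<chi> = trivial_char \<Longrightarrow> x \<noteq> 0 \<Longrightarrow> \<chi> x = 1"
  by (simp add: trivial_char_def)

text \<open>The sum \<open>E\<close> of the overview. The attached characters are \<phi> T at 0,
  T^(-3) at 1, T^(-1) at -3 and, in the coordinate 1/t, \<phi> T^3 at infinity.\<close>

definition kernel_sum :: "('a :: {field, finite} \<Rightarrow> complex) \<Rightarrow> complex" where
  "kernel_sum T = (\<Sum>t\<in>UNIV. quad_char t * T (t / ((1 - t) ^ 3 * (3 + t))))"

text \<open>
  With \<open>y = (r + 1) / (r - 1)\<close> the polynomial \<open>1 - y\<^sup>3\<close> becomes a function of \<open>r\<^sup>2\<close> up to a
  power of \<open>1 - r\<close>, so that \<open>sum_square_roots\<close> applies; the sum over \<open>\<rho> = r\<^sup>2\<close> is then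
  a Jacobi sum.
\<close>

lemma sum_one_minus_cube:
  fixes T :: "'a :: {field, finite} \<Rightarrow> complex"
  defines "S \<equiv> T ^\<^sub>c 2" and "B \<equiv> T ^\<^sub>c (-3)"
  assumes two: "(2 :: 'a) \<noteq> 0" and three: "(3 :: 'a) \<noteq> 0"
    and T: "mult_char T" and nt: "quad_char \<cdot>\<^sub>c B \<noteq> trivial_char" "S \<cdot>\<^sub>c B \<noteq> trivial_char"
  shows "T (-1) * jacobi_sum quad_char B * (\<Sum>y\<in>UNIV. S (1 - y ^ 3))
    = T 108 * jacobi_sum S B * kernel_sum T"
proof -
  have S: "mult_char S" and B: "mult_char B"
    using T by (simp_all add: S_def B_def mult_char_char_pow)
  have Sx: "S x = T (x ^ 2)" and Bx: "B x = T (inverse (x ^ 3))" for x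
    using T by (simp_all add: S_def B_def char_pow_numeral)
  have "(\<Sum>y\<in>UNIV. S (1 - y ^ 3)) = (\<Sum>r\<in>UNIV. S 2 * (S (1 + 3 * r ^ 2) * B (1 - r) ^ 2))"
  proof (rule sum_reindex_punctured [where a = 1 and b = 1
        and i = "\<lambda>r. (r + 1) / (r - 1)" and j = "\<lambda>y. (y + 1) / (y - 1)"])
    fix y :: 'a assume "y \<noteq> 1"
    then have y: "y - 1 \<noteq> 0" by simp
    define r where "r = (y + 1) / (y - 1)"
    have r: "r - 1 = 2 / (y - 1)" using y by (simp add: r_def field_simps)
    then have r1: "r - 1 \<noteq> 0" using two y by simp
    have "y * (r - 1) = r + 1" unfolding r using y by (simp add: r_def field_simps)
    then have yr: "y = (r + 1) / (r - 1)" using r1 by (simp add: field_simps)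
    show "r \<noteq> 1" using r1 by simp
    show "(r + 1) / (r - 1) = y" using yr by simp
    have "(1 - y ^ 3) * (1 - r) ^ 3 = 2 * (1 + 3 * r ^ 2)"
    proof -
      have "y ^ 3 * (1 - r) ^ 3 = - ((y * (r - 1)) ^ 3)"
        by (simp add: algebra_simps power3_eq_cube)
      also have "\<dots> = - ((r + 1) ^ 3)" unfolding \<open>y * (r - 1) = r + 1\<close> ..
      finally show ?thesis by (simp add: algebra_simps power3_eq_cube power2_eq_square)
    qed
    then have "1 - y ^ 3 = 2 * (1 + 3 * r ^ 2) * inverse ((1 - r) ^ 3)"
      using r1 by (simp add: field_simps)
    then show "S 2 * (S (1 + 3 * r ^ 2) * B (1 - r) ^ 2) = S (1 - y ^ 3)"
      using T by (simp only: Sx Bx char_times char_power power_mult_distrib mult_ac)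
    show "(y + 1) / (y - 1) \<noteq> 1" "((y + 1) / (y - 1) + 1) / ((y + 1) / (y - 1) - 1) = y"
      using \<open>r \<noteq> 1\<close> \<open>(r + 1) / (r - 1) = y\<close> by (simp_all add: r_def)
  qed (use S B in \<open>auto simp: char_zero\<close>)
  also have "\<dots> = S 2 * (\<Sum>r\<in>UNIV. S (1 + 3 * r ^ 2) * B (1 - r) ^ 2)"
    by (simp only: sum_distrib_left)
  also have "(\<Sum>r\<in>UNIV. S (1 + 3 * r ^ 2) * B (1 - r) ^ 2)
      = (\<Sum>\<rho>\<in>UNIV. \<Sum>r | r \<in> UNIV \<and> r ^ 2 = \<rho>. S (1 + 3 * r ^ 2) * B (1 - r) ^ 2)"
    by (rule sum.group [symmetric]) auto
  also have "\<dots> = (\<Sum>\<rho>\<in>UNIV. S (1 + 3 * \<rho>) * (\<Sum>r | r ^ 2 = \<rho>. B (1 - r) ^ 2))"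
    by (auto simp: sum_distrib_left intro!: sum.cong)
  finally have "T (-1) * jacobi_sum quad_char B * (\<Sum>y\<in>UNIV. S (1 - y ^ 3))
      = S 2 * (\<Sum>\<rho>\<in>UNIV. S (1 + 3 * \<rho>) *
          (B (-1) * jacobi_sum quad_char B * (\<Sum>r | r ^ 2 = \<rho>. B (1 - r) ^ 2)))"
    using T by (simp add: Bx sum_distrib_left mult_ac)
  also have "(\<Sum>\<rho>\<in>UNIV. S (1 + 3 * \<rho>) *
        (B (-1) * jacobi_sum quad_char B * (\<Sum>r | r ^ 2 = \<rho>. B (1 - r) ^ 2)))
      = (\<Sum>\<rho>\<in>UNIV. S (1 + 3 * \<rho>) * (\<Sum>t\<in>UNIV. quad_char t * B ((1 - t) * (1 - \<rho> * t) / t)))"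
    by (simp only: sum_square_roots [OF two B nt(1)])
  also have "\<dots> = (\<Sum>t\<in>UNIV. \<Sum>\<rho>\<in>UNIV. S (1 + 3 * \<rho>) * (quad_char t * B ((1 - t) * (1 - \<rho> * t) / t)))"
    unfolding sum_distrib_left by (rule sum.swap)
  also have "\<dots> = (\<Sum>t\<in>UNIV. quad_char t * B ((1 - t) / t) * (\<Sum>\<rho>\<in>UNIV. S (1 + 3 * \<rho>) * B (1 - \<rho> * t)))"
    unfolding sum_distrib_left
    by (intro sum.cong refl) (simp add: char_simps [OF B])
  also have "\<dots> = (\<Sum>t\<in>UNIV. T 27 * jacobi_sum S B * (quad_char t * T (t / ((1 - t) ^ 3 * (3 + t)))))"
  proof (rule sum.cong [OF refl])
    fix t :: 'a
    show "quad_char t * B ((1 - t) / t) * (\<Sum>\<rho>\<in>UNIV. S (1 + 3 * \<rho>) * B (1 - \<rho> * t))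
        = T 27 * jacobi_sum S B * (quad_char t * T (t / ((1 - t) ^ 3 * (3 + t))))"
    proof (cases "t = 0")
      case True
      then show ?thesis by (simp add: quad_char_simps)
    next
      case False
      \<comment> \<open>With u = 1 + 3 \<rho> this is a convolution at (3 + t) / t. That point is 0
        for t = -3, where nontriviality of the product of \<open>S\<close> and \<open>B\<close> is
        essential.\<close>
      have "(\<Sum>\<rho>\<in>UNIV. S (1 + 3 * \<rho>) * B (1 - \<rho> * t))
          = (\<Sum>u\<in>UNIV. B (t / 3) * (S u * B ((3 + t) / t - u)))"
      proof (rule sum.reindex_bij_witness [of _ "\<lambda>u. (u - 1) / 3" "\<lambda>\<rho>. 1 + 3 * \<rho>"])
        fix \<rho> :: 'a
        have "1 - \<rho> * t = t / 3 * ((3 + t) / t - (1 + 3 * \<rho>))"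
          using three False by (simp add: field_simps)
        then show "B (t / 3) * (S (1 + 3 * \<rho>) * B ((3 + t) / t - (1 + 3 * \<rho>)))
            = S (1 + 3 * \<rho>) * B (1 - \<rho> * t)"
          by (simp only: char_times [OF B] mult_ac)
      qed (use three in \<open>auto simp: diff_divide_distrib\<close>)
      also have "\<dots> = B (t / 3) * (S ((3 + t) / t) * B ((3 + t) / t) * jacobi_sum S B)"
        unfolding sum_distrib_left [symmetric]
        by (subst sum_char_convolution [OF S B disjI2 [OF nt(2)]]) (rule refl)
      finally have "quad_char t * B ((1 - t) / t) * (\<Sum>\<rho>\<in>UNIV. S (1 + 3 * \<rho>) * B (1 - \<rho> * t))
          = quad_char t * jacobi_sum S B *
            (B ((1 - t) / t) * B (t / 3) * S ((3 + t) / t) * B ((3 + t) / t))"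
        by (simp only: mult_ac)
      also have "B ((1 - t) / t) * B (t / 3) * S ((3 + t) / t) * B ((3 + t) / t)
          = T (inverse (((1 - t) / t) ^ 3) * inverse ((t / 3) ^ 3) * ((3 + t) / t) ^ 2 *
              inverse (((3 + t) / t) ^ 3))"
        by (simp only: Sx Bx char_times [OF T])
      also have "inverse (((1 - t) / t) ^ 3) * inverse ((t / 3) ^ 3) * ((3 + t) / t) ^ 2 *
              inverse (((3 + t) / t) ^ 3) = 27 * (t / ((1 - t) ^ 3 * (3 + t)))"
      proof (cases "1 - t = 0 \<or> 3 + t = 0")
        case 1: False
        then show ?thesis using three False
          by (simp add: power_divide divide_simps) (simp add: power3_eq_cube power2_eq_square)
      qed auto
      finally show ?thesis by (simp only: char_times [OF T] mult_ac)
    qed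
  qed
  \<comment> \<open>The constant is 108 = 2^2 * 27, with 2^2 from the factor 2 in 1 - y^3 and 27
    from the inner sums.\<close>
  also have "S 2 * \<dots> = T 108 * jacobi_sum S B * kernel_sum T"
    using char_times [OF T, of "2 ^ 2" 27]
    by (simp only: kernel_sum_def Sx flip: sum_distrib_left) simp
  finally show ?thesis .
qed

text \<open>Besides 1 there are the roots of y^2 + y + 1, which the substitution 2 y + 1 identifies
  with the square roots of the discriminant -3. The two kinds are disjoint since 3 is
  nonzero.\<close>

lemma card_cube_roots_of_unity:
  assumes two: "(2 :: 'a :: {field, finite}) \<noteq> 0" and three: "(3 :: 'a) \<noteq> 0"
  shows "of_nat (card {y :: 'a. y ^ 3 = 1}) = 2 + quad_char (- 3 :: 'a)"
proof -
  have "{y :: 'a. y ^ 3 = 1} = insert 1 {y. y ^ 2 + y + 1 = 0}"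
  proof -
    have "y ^ 3 = 1 \<longleftrightarrow> (y - 1) * (y ^ 2 + y + 1) = 0" for y :: 'a
      by (simp add: algebra_simps power2_eq_square power3_eq_cube)
    then show ?thesis by auto
  qed
  moreover have "1 \<notin> {y :: 'a. y ^ 2 + y + 1 = 0}" using three by simp
  moreover have "bij_betw (\<lambda>y. 2 * y + 1) {y :: 'a. y ^ 2 + y + 1 = 0} {r. r ^ 2 = - 3}"
  proof (rule bij_betw_byWitness [where f' = "\<lambda>r. (r - 1) / 2"])
    have eq: "(2 * y + 1) ^ 2 = 4 * (y ^ 2 + y + 1) - 3" for y :: 'a
      by (simp add: algebra_simps power2_eq_square)
    show "(\<lambda>y. 2 * y + 1) ` {y :: 'a. y ^ 2 + y + 1 = 0} \<subseteq> {r. r ^ 2 = - 3}"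
      by (auto simp: eq)
    show "(\<lambda>r. (r - 1) / 2) ` {r :: 'a. r ^ 2 = - 3} \<subseteq> {y. y ^ 2 + y + 1 = 0}"
    proof clarify
      fix r :: 'a assume r: "r ^ 2 = - 3"
      define y where "y = (r - 1) / 2"
      have "2 * y + 1 = r" using two by (simp add: y_def diff_divide_distrib)
      moreover have "2 * (2 * (y ^ 2 + y + 1)) = (2 * y + 1) ^ 2 + 3" by (simp add: eq)
      ultimately have "2 * (2 * (y ^ 2 + y + 1)) = 0" using r by simp
      then show "((r - 1) / 2) ^ 2 + (r - 1) / 2 + 1 = 0"
        using two unfolding y_def by (simp only: mult_eq_0_iff) simp
    qed
  qed (use two in \<open>auto simp: diff_divide_distrib\<close>)
  then have "card {y :: 'a. y ^ 2 + y + 1 = 0} = card {r :: 'a. r ^ 2 = - 3}"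
    by (rule bij_betw_same_card)
  ultimately show ?thesis using card_square_roots [OF two, of "- 3"] by simp
qed

section \<open>The degenerate case of trivial \<open>S\<close>, and the comparison of both
  sums\<close>

lemma jacobi_sum_quad_trivial:
  assumes "(2 :: 'a :: {field, finite}) \<noteq> 0"
  shows "jacobi_sum quad_char (trivial_char :: 'a \<Rightarrow> complex) = - 1"
proof -
  have "jacobi_sum quad_char (trivial_char :: 'a \<Rightarrow> complex) = (\<Sum>x\<in>UNIV - {1 :: 'a}. quad_char x)"
    unfolding jacobi_sum_def
    by (rule sum.mono_neutral_cong_right) (auto simp: trivial_char_def)
  also have "\<dots> = - 1"
    using sum_nontrivial_char [OF mult_char_quad quad_char_nontrivial [OF assms]]
    by (simp add: sum_diff1 quad_char_simps)
  finally show ?thesis .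
qed

text \<open>Such a \<open>T\<close> takes the values 1 and -1 and is 1 on squares. If it is -1 at
  some \<open>a\<close>, then \<open>a\<close> is a nonsquare, and every nonsquare times
  \<open>a\<close> is a square, which forces \<open>T\<close> to be -1 on all nonsquares.\<close>

lemma square_trivial_char:
  fixes T :: "'a :: {field, finite} \<Rightarrow> complex"
  assumes T: "mult_char T" and sq: "T ^\<^sub>c 2 = trivial_char"
  shows "T = trivial_char \<or> T = quad_char"
proof (rule disjCI)
  assume "T \<noteq> quad_char"
  have T2: "T x * T x = 1" if "x \<noteq> 0" for x
    using trivial_charD [OF sq that] T
    by (simp add: char_pow_numeral char_simps power2_eq_square)
  then have pm: "T x = 1 \<or> T x = - 1" if "x \<noteq> 0" for x
    using that by (simp add: square_eq_1_iff)
  have sq1: "T (x ^ 2) = 1" if "x \<noteq> 0" for x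
    using T2 [OF that] T by (simp add: char_simps power2_eq_square)
  show "T = trivial_char"
  proof (rule eq_trivial_charI [OF T], rule ccontr)
    fix a assume a: "a \<noteq> 0" "T a \<noteq> 1"
    then have Ta: "T a = - 1" using pm by blast
    have "a \<noteq> y ^ 2" for y using sq1 [of y] a by auto
    then have qa: "quad_char a = - 1" using a by (simp add: quad_char_def)
    have "T x = quad_char x" for x
    proof (cases "x = 0")
      case x: False
      show ?thesis
      proof (cases "\<exists>y. x = y ^ 2")
        case True
        then obtain y where "x = y ^ 2" by blast
        then show ?thesis using x sq1 [of y] quad_char_square [of y] by auto
      next
        case False
        then have qx: "quad_char x = - 1" using x by (simp add: quad_char_def)
        then have "quad_char (x * a) = 1" using qa by (simp add: quad_char_simps)
        then have "\<exists>y. x * a = y ^ 2" "x * a \<noteq> 0"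
          unfolding quad_char_def by (metis one_neq_neg_one zero_neq_one)+
        then obtain y where "x * a = y ^ 2" "x * a \<noteq> 0" by blast
        then have "T x * T a = 1" using sq1 [of y] T by (auto simp flip: char_times)
        then show ?thesis using Ta qx pm [OF x] by auto
      qed
    qed (simp add: T char_zero quad_char_simps)
    then show False using \<open>T \<noteq> quad_char\<close> by auto
  qed
qed

text \<open>For trivial \<open>T\<close> this is the vanishing sum of \<phi> without the points 1
  and -3. For T = \<phi> the summand becomes \<phi>(1 - t) \<phi>(3 + t) with t = 0 left out, so the
  value is J(\<phi>, \<phi>) - \<phi>(3); the factor 108 = 3 * 6^2 contributes \<phi>(3).\<close>

lemma kernel_sum_eq_trivial:
  fixes T :: "'a :: {field, finite} \<Rightarrow> complex"
  assumes two: "(2 :: 'a) \<noteq> 0" and three: "(3 :: 'a) \<noteq> 0"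
    and T: "T = trivial_char \<or> T = quad_char"
  shows "T 108 * kernel_sum T = - 1 - quad_char (- 3 :: 'a)"
proof -
  have four: "(4 :: 'a) \<noteq> 0"
  proof
    assume "(4 :: 'a) = 0"
    then have "2 * 2 = (0 :: 'a)" by simp
    then show False using two by (simp only: mult_eq_0_iff) simp
  qed
  have "(108 :: 'a) = 3 * (2 * 3) ^ 2" by simp
  have "2 * 3 \<noteq> (0 :: 'a)" using two three by (simp only: mult_eq_0_iff simp_thms)
  from T show ?thesis
  proof
    assume T: "T = trivial_char"
    have "(1 :: 'a) \<noteq> - 3" using four by (auto simp: eq_neg_iff_add_eq_0)
    have "(108 :: 'a) \<noteq> 0"
      using no_zero_divisors [OF three power_not_zero [OF \<open>2 * 3 \<noteq> 0\<close>, of 2]]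
      by simp
    have "kernel_sum T = (\<Sum>t\<in>UNIV - {1, - 3 :: 'a}. quad_char t)"
      unfolding kernel_sum_def T
      by (rule sum.mono_neutral_cong_right)
        (auto simp: trivial_char_def quad_char_simps add_eq_0_iff)
    also have "\<dots> = (\<Sum>t\<in>(UNIV :: 'a set). quad_char t) - (\<Sum>t\<in>{1, - 3 :: 'a}. quad_char t)"
      by (rule sum_diff) auto
    also have "\<dots> = - 1 - quad_char (- 3 :: 'a)"
      using \<open>1 \<noteq> - 3\<close> sum_nontrivial_char [OF mult_char_quad quad_char_nontrivial [OF two]]
      by (simp add: quad_char_simps)
    finally show ?thesis using \<open>108 \<noteq> 0\<close> T by (simp add: trivial_char_def)
  next
    assume T: "T = quad_char"
    have "quad_char (4 :: 'a) = 1" using quad_char_square [OF two] by simp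
    have inv: "quad_char ^\<^sub>c (-1) = (quad_char :: 'a \<Rightarrow> complex)"
      by (simp add: fun_eq_iff char_pow_minus_one mult_char_quad quad_char_simps inverse_quad_char)
    have "kernel_sum T = (\<Sum>t\<in>UNIV - {0 :: 'a}. quad_char (1 - t) * quad_char (3 + t))"
      unfolding kernel_sum_def T
    proof (rule sum.mono_neutral_cong_right)
      fix t :: 'a assume "t \<in> UNIV - {0}"
      then have "quad_char t * quad_char t = 1" by (simp add: quad_char_mult_self)
      moreover have "quad_char (1 - t) ^ 3 = quad_char (1 - t)"
        by (cases "1 - t = 0") (simp_all add: power3_eq_cube quad_char_mult_self quad_char_simps)
      ultimately show "quad_char t * quad_char (t / ((1 - t) ^ 3 * (3 + t)))
          = quad_char (1 - t) * quad_char (3 + t)"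
        by (simp add: quad_char_simps divide_inverse inverse_quad_char flip: mult.assoc)
    qed (auto simp: quad_char_simps)
    also have "\<dots> = (\<Sum>t\<in>(UNIV :: 'a set). quad_char (1 - t) * quad_char (3 + t)) - quad_char (3 :: 'a)"
      by (simp add: sum_diff1 quad_char_simps)
    also have "(\<Sum>t\<in>(UNIV :: 'a set). quad_char (1 - t) * quad_char (3 + t))
        = (\<Sum>u\<in>UNIV. quad_char u * quad_char (4 - u :: 'a))"
      by (rule sum.reindex_bij_witness [of _ "\<lambda>u. 1 - u" "\<lambda>t. 1 - t"]) auto
    also have "\<dots> = jacobi_sum quad_char (quad_char :: 'a \<Rightarrow> complex)"
      using sum_char_convolution [OF mult_char_quad mult_char_quad disjI1 [OF four]]
      by (simp add: \<open>quad_char (4 :: 'a) = 1\<close>)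
    also have "\<dots> = - quad_char (- 1 :: 'a)"
      using jacobi_sum_inverse_self [OF mult_char_quad quad_char_nontrivial [OF two]]
      by (simp only: inv)
    finally have "kernel_sum T = - quad_char (- 1 :: 'a) - quad_char (3 :: 'a)" .
    moreover have "T 108 = quad_char (3 :: 'a)"
      unfolding \<open>108 = 3 * (2 * 3) ^ 2\<close> T using quad_char_square [OF \<open>2 * 3 \<noteq> 0\<close>]
      by (simp only: char_times [OF mult_char_quad] mult_1_right)
    moreover have "quad_char (- 3 :: 'a) = quad_char (3 :: 'a) * quad_char (- 1 :: 'a)"
      using char_uminus [OF mult_char_quad, of "3 :: 'a"] by (simp only: mult.commute)
    ultimately show ?thesis
      using quad_char_mult_self [OF three] by (simp add: right_diff_distrib)
  qed
qed

lemma quad_char_power4: "x \<noteq> 0 \<Longrightarrow> quad_char x * quad_char x * quad_char x * quad_char x = 1"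
  by (simp add: quad_char_def)

text \<open>The subtracted sum of \<open>S\<close> is 0 for nontrivial \<open>S\<close> and q - 1
  for trivial \<open>S\<close>. With it one formula covers both cases, and it removes precisely the
  contribution of the trivial character when cube roots are counted later.\<close>

lemma kernel_sum_eq:
  fixes T :: "'a :: {field, finite} \<Rightarrow> complex"
  defines "S \<equiv> T ^\<^sub>c 2"
  assumes two: "(2 :: 'a) \<noteq> 0" and three: "(3 :: 'a) \<noteq> 0"
    and T: "mult_char T" and S3: "S \<noteq> trivial_char \<Longrightarrow> S ^\<^sub>c 3 \<noteq> trivial_char"
  shows "jacobi_sum quad_char S * T 108 * kernel_sum T
    = jacobi_sum (T ^\<^sub>c (-1)) (T ^\<^sub>c 3 \<cdot>\<^sub>c quad_char) *
      ((\<Sum>y\<in>UNIV. S (1 - y ^ 3)) - (\<Sum>x\<in>UNIV. S x))"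
proof (cases "S = trivial_char")
  case True
  have T': "T = trivial_char \<or> T = quad_char"
    using square_trivial_char [OF T] True by (simp add: S_def)
  have J: "jacobi_sum (T ^\<^sub>c (-1)) (T ^\<^sub>c 3 \<cdot>\<^sub>c quad_char) = - 1"
    using T'
  proof
    assume T1: "T = trivial_char"
    have "T ^\<^sub>c (-1) = trivial_char" "T ^\<^sub>c 3 \<cdot>\<^sub>c quad_char = quad_char"
      using T1 by (auto simp: fun_eq_iff char_pow_def char_mult_def trivial_char_def quad_char_simps)
    then show ?thesis using jacobi_sum_quad_trivial [OF two] by (simp add: jacobi_sum_commute)
  next
    assume T1: "T = quad_char"
    have "T ^\<^sub>c (-1) = quad_char"
      using T1 by (auto simp: fun_eq_iff char_pow_def inverse_quad_char quad_char_simps)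
    moreover have "T ^\<^sub>c 3 \<cdot>\<^sub>c quad_char = trivial_char"
      unfolding T1 using quad_char_power4
      by (auto simp: fun_eq_iff char_pow_numeral mult_char_quad char_mult_def trivial_char_def
          quad_char_simps power3_eq_cube)
    ultimately show ?thesis using jacobi_sum_quad_trivial [OF two] by simp
  qed
  have "(\<Sum>y\<in>UNIV. S (1 - y ^ 3)) = (\<Sum>y\<in>UNIV - {y :: 'a. y ^ 3 = 1}. 1)"
    unfolding True by (rule sum.mono_neutral_cong_right) (auto simp: trivial_char_def)
  also have "\<dots> = of_nat CARD('a) - of_nat (card {y :: 'a. y ^ 3 = 1})"
    by (simp add: card_Diff_subset of_nat_diff card_mono)
  finally have "(\<Sum>y\<in>UNIV. S (1 - y ^ 3)) - (\<Sum>x\<in>UNIV. S x) = - 1 - quad_char (- 3 :: 'a)"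
    by (simp add: True sum_trivial_char card_cube_roots_of_unity [OF two three])
  then show ?thesis
    using kernel_sum_eq_trivial [OF two three T']
    by (simp add: J True jacobi_sum_quad_trivial [OF two])
next
  case False
  define B where "B = T ^\<^sub>c (-3)"
  \<comment> \<open>Chosen so that S C = \<phi>, while S B = T^(-1): the exchange identity for
    \<open>S\<close>, \<open>B\<close>, \<open>C\<close> then contains exactly the Jacobi sums to be
    converted.\<close>
  define C where "C = quad_char \<cdot>\<^sub>c T ^\<^sub>c (-2)"
  have S: "mult_char S" and B: "mult_char B" and C: "mult_char C"
    using T by (simp_all add: S_def B_def C_def mult_char_char_pow mult_char_char_mult mult_char_quad)
  have vals: "S x = T x ^ 2" "B x = inverse (T x ^ 3)" "C x = quad_char x * inverse (T x ^ 2)"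
    "(T ^\<^sub>c (-1)) x = inverse (T x)" "(T ^\<^sub>c 3) x = T x ^ 3" for x
    using T by (simp_all add: S_def B_def C_def char_mult_def char_pow_numeral char_simps)
  have T0: "T x = 0 \<longleftrightarrow> x = 0" for x using T by (rule char_eq_0_iff)
  have \<phi>nt: "quad_char \<noteq> (trivial_char :: 'a \<Rightarrow> complex)" by (rule quad_char_nontrivial [OF two])
  \<comment> \<open>One point where T^6 differs from 1 witnesses that \<open>B\<close>, \<phi> B and
    S B are all nontrivial.\<close>
  have S3': "\<exists>x. x \<noteq> 0 \<and> T x ^ 6 \<noteq> 1"
  proof (rule ccontr)
    assume "\<not> ?thesis"
    then have "(T x ^ 2) ^ 3 = 1" if "x \<noteq> 0" for x using that by auto
    then have "S ^\<^sub>c 3 = trivial_char"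
      using S by (intro eq_trivial_charI mult_char_char_pow) (simp_all add: char_pow_numeral char_power T vals)
    then show False using S3 False by blast
  qed
  then obtain a where a: "a \<noteq> 0" "T a ^ 6 \<noteq> 1" by blast
  have Bnt: "B \<noteq> trivial_char"
  proof
    assume "B = trivial_char"
    from trivial_charD [OF this a(1)] have "T a ^ 3 = 1" by (simp add: vals)
    then have "(T a ^ 3) ^ 2 = 1" by simp
    then show False using a(2) by simp
  qed
  have \<phi>B: "quad_char \<cdot>\<^sub>c B \<noteq> trivial_char"
  proof
    assume "quad_char \<cdot>\<^sub>c B = trivial_char"
    from trivial_charD [OF this a(1)] have "quad_char a * inverse (T a ^ 3) = 1"
      by (simp add: vals char_mult_def)
    then have "T a ^ 3 = quad_char a" using a T0 by (simp add: field_simps)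
    then have "(T a ^ 3) ^ 2 = 1" using quad_char_mult_self [OF a(1)] by (simp add: power2_eq_square)
    then show False using a(2) by simp
  qed
  have SB: "S \<cdot>\<^sub>c B = T ^\<^sub>c (-1)"
    using T0 by (auto simp: fun_eq_iff char_mult_def vals field_simps power2_eq_square power3_eq_cube)
  have SBnt: "S \<cdot>\<^sub>c B \<noteq> trivial_char"
  proof
    assume "S \<cdot>\<^sub>c B = trivial_char"
    from trivial_charD [OF this a(1)] have "T a = 1" by (simp add: SB vals)
    then show False using a(2) by simp
  qed
  have SC: "S \<cdot>\<^sub>c C = quad_char"
  proof
    show "(S \<cdot>\<^sub>c C) x = quad_char x" for x
      by (cases "x = 0") (simp_all add: T0 char_mult_def vals quad_char_simps)
  qed
  have ex: "jacobi_sum S B * jacobi_sum (T ^\<^sub>c (-1)) C = jacobi_sum S C * jacobi_sum quad_char B"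
    using jacobi_sum_exchange [OF S B C SBnt] \<phi>nt by (simp add: SB SC)
  have S1: "S (-1) = 1" using char_minus_one_mult_self [OF T] by (simp add: vals power2_eq_square)
  have "quad_char ^\<^sub>c (-1) = (quad_char :: 'a \<Rightarrow> complex)"
    by (simp add: fun_eq_iff char_pow_minus_one mult_char_quad quad_char_simps inverse_quad_char)
  then have JSC: "jacobi_sum S C = jacobi_sum quad_char S"
    using jacobi_sum_inverse [OF S C] S1 by (simp add: SC jacobi_sum_commute)
  have "(T ^\<^sub>c (-1) \<cdot>\<^sub>c C) ^\<^sub>c (-1) = T ^\<^sub>c 3 \<cdot>\<^sub>c quad_char"
    using T0 by (auto simp: fun_eq_iff char_pow_minus_one mult_char_char_mult mult_char_char_pow T C)
      (simp add: char_mult_def vals char_inverse T mult_char_quad inverse_quad_char power2_eq_square power3_eq_cube)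
  then have JTC: "jacobi_sum (T ^\<^sub>c (-1)) C = T (-1) * jacobi_sum (T ^\<^sub>c (-1)) (T ^\<^sub>c 3 \<cdot>\<^sub>c quad_char)"
    using jacobi_sum_inverse [OF mult_char_char_pow [OF T] C, of "-1"] char_inverse [OF T, of "-1"]
    by (simp add: vals)
  have sq: "T (-1) * T (-1) = 1" by (rule char_minus_one_mult_self [OF T])
  let ?M = "\<Sum>y\<in>UNIV. S (1 - y ^ 3)" and ?J = "jacobi_sum (T ^\<^sub>c (-1)) (T ^\<^sub>c 3 \<cdot>\<^sub>c quad_char)"
  have cube: "T (-1) * jacobi_sum quad_char B * ?M = T 108 * jacobi_sum S B * kernel_sum T"
    using sum_one_minus_cube [OF two three T] \<phi>B SBnt by (simp add: S_def B_def)
  have "jacobi_sum S B * (jacobi_sum quad_char S * T 108 * kernel_sum T)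
      = jacobi_sum quad_char S * (T (-1) * jacobi_sum quad_char B * ?M)"
    unfolding cube by (simp only: mult_ac)
  also have "\<dots> = T (-1) * (jacobi_sum S C * jacobi_sum quad_char B) * ?M"
    unfolding JSC by (simp only: mult_ac)
  also have "\<dots> = (T (-1) * T (-1)) * (jacobi_sum S B * ?J) * ?M"
    unfolding ex [symmetric] JTC by (simp only: mult_ac)
  also have "\<dots> = jacobi_sum S B * (?J * ?M)"
    unfolding sq by (simp only: mult_ac mult_1_left)
  finally have "jacobi_sum quad_char S * T 108 * kernel_sum T = ?J * ?M"
    using jacobi_sum_nonzero [OF S False B Bnt] by simp
  then show ?thesis using sum_nontrivial_char [OF S False] by simp
qed

section \<open>The four evaluations\<close>

text \<open>Here \<open>j\<close> is the Moebius map with pole 1/x and \<open>b\<close> is its value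
  at infinity. Both excluded summands are 0: A 0 on one side, and on the other \<phi>(0), or
  \<open>T\<close> at a quotient with denominator 0.\<close>

lemma gauss_2F1_eq_kernel_sum:
  fixes A B C T :: "'a :: {field, finite} \<Rightarrow> complex"
  assumes A: "mult_char A" and B: "mult_char B" and C: "mult_char C" and T: "mult_char T"
    and x: "x \<noteq> 0" and b: "b = 0 \<or> b = - 3"
    and i: "\<And>s. s \<noteq> b \<Longrightarrow> x * i s \<noteq> 1" "\<And>s. s \<noteq> b \<Longrightarrow> j (i s) = s"
    and j: "\<And>t. x * t \<noteq> 1 \<Longrightarrow> j t \<noteq> b" "\<And>t. x * t \<noteq> 1 \<Longrightarrow> i (j t) = t"
    and eq: "\<And>t. x * t \<noteq> 1 \<Longrightarrow> B (t / (1 - t)) * C (1 - t) * A (1 / (1 - x * t))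
      = c * (quad_char (j t) * T (j t / ((1 - j t) ^ 3 * (3 + j t))))"
  shows "gauss_2F1 A B C x = B (- 1) * C (- 1) * c * kernel_sum T / of_nat CARD('a)"
proof -
  have x1: "x * t \<noteq> 1 \<longleftrightarrow> t \<noteq> 1 / x" for t using x by (simp add: field_simps)
  have "(\<Sum>t\<in>UNIV. B (t / (1 - t)) * C (1 - t) * A (1 / (1 - x * t)))
      = (\<Sum>s\<in>UNIV. c * (quad_char s * T (s / ((1 - s) ^ 3 * (3 + s)))))"
    by (rule sum_reindex_punctured [where a = "1 / x" and b = b and i = i and j = j])
      (use A T x b i j eq in \<open>auto simp: x1 char_zero mult_char_quad\<close>)
  then show ?thesis
    by (simp add: gauss_2F1_eq_sum [OF A B C x] kernel_sum_def flip: sum_distrib_left)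
qed

lemma twisted_mult_char:
  assumes T: "mult_char T"
  shows "mult_char T" "mult_char (T ^\<^sub>c k)" "mult_char (T ^\<^sub>c k \<cdot>\<^sub>c quad_char)" "mult_char (T \<cdot>\<^sub>c quad_char)"
  using T by (simp_all add: mult_char_char_pow mult_char_char_mult mult_char_quad)

lemma char_pow_at_minus_one:
  assumes T: "mult_char T"
  shows "(T ^\<^sub>c (-1)) (- 1) = T (- 1)" "(T ^\<^sub>c (-2)) (- 1) = 1"
    "(T ^\<^sub>c (-3)) (- 1) = T (- 1)" "(T ^\<^sub>c (-4)) (- 1) = 1"
  using T by (simp_all add: char_pow_numeral char_one)

lemma numeral_nonzero:
  assumes two: "(2 :: 'a :: field) \<noteq> 0" and three: "(3 :: 'a) \<noteq> 0"
  shows "(4 :: 'a) \<noteq> 0" "(12 :: 'a) \<noteq> 0" "(27 :: 'a) \<noteq> 0" "(64 :: 'a) \<noteq> 0"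
    "(256 :: 'a) \<noteq> 0" "(768 :: 'a) \<noteq> 0" "(20736 :: 'a) \<noteq> 0"
proof -
  show 4: "(4 :: 'a) \<noteq> 0" using no_zero_divisors [OF two two] by simp
  show "(12 :: 'a) \<noteq> 0" using no_zero_divisors [OF 4 three] by simp
  show "(27 :: 'a) \<noteq> 0" using power_not_zero [OF three, of 3] by simp
  show "(64 :: 'a) \<noteq> 0" using power_not_zero [OF two, of 6] by simp
  show "(768 :: 'a) \<noteq> 0" using no_zero_divisors [OF power_not_zero [OF two, of 8] three] by simp
  show "(20736 :: 'a) \<noteq> 0"
    using no_zero_divisors [OF power_not_zero [OF two, of 8] power_not_zero [OF three, of 4]] by simp
  show "(256 :: 'a) \<noteq> 0" using power_not_zero [OF two, of 8] by simp
qed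

context
  fixes T :: "'a :: {field, finite} \<Rightarrow> complex"
  assumes two: "(2 :: 'a) \<noteq> 0" and three: "(3 :: 'a) \<noteq> 0" and T: "mult_char T"
begin

private lemmas nonzero = three numeral_nonzero [OF two three]

text \<open>The series attaches T^(-3), T^(-1), \<phi> T^3 and \<phi> T to 0, 1, 3/4 and infinity.
  Comparing with \<open>kernel_sum\<close>, these points must go to 1, -3, infinity and 0, which
  determines \<open>j\<close>.\<close>

lemma gauss_2F1_four_thirds:
  "gauss_2F1 (T ^\<^sub>c (-3) \<cdot>\<^sub>c quad_char) (T ^\<^sub>c (-3)) (T ^\<^sub>c (-4)) (4 / 3)
    = T (256 / 27) * kernel_sum T / of_nat CARD('a)"
proof -
  define i :: "'a \<Rightarrow> 'a" where "i s = 3 * (s - 1) / (4 * s)" for s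
  define j :: "'a \<Rightarrow> 'a" where "j t = 3 / (3 - 4 * t)" for t
  have "gauss_2F1 (T ^\<^sub>c (-3) \<cdot>\<^sub>c quad_char) (T ^\<^sub>c (-3)) (T ^\<^sub>c (-4)) (4 / 3)
      = (T ^\<^sub>c (-3)) (- 1) * (T ^\<^sub>c (-4)) (- 1) * T (- 256 / 27) * kernel_sum T / of_nat CARD('a)"
  proof (rule gauss_2F1_eq_kernel_sum [where b = 0 and i = i and j = j])
    fix s :: 'a assume s: "s \<noteq> 0"
    have Di: "3 - 4 * i s = 3 / s"
      using s nonzero by (simp add: i_def field_simps)
    show "4 / 3 * i s \<noteq> 1"
    proof
      assume "4 / 3 * i s = 1"
      then have "3 - 4 * i s = 0" using nonzero by (auto simp: field_simps add_eq_0_iff)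
      then show False using Di s nonzero by auto
    qed
    from Di show "j (i s) = s"
      using s nonzero unfolding j_def by simp
  next
    fix t :: 'a assume "4 / 3 * t \<noteq> 1"
    define d e where "d = 3 - 4 * t" and "e = 1 - t"
    have d: "d \<noteq> 0" using \<open>4 / 3 * t \<noteq> 1\<close> nonzero
      by (auto simp: d_def field_simps add_eq_0_iff)
    have xt: "1 - 4 / 3 * t = d / 3" using nonzero by (simp add: d_def field_simps)
    have x: "1 / (1 - 4 / 3 * t) = j t"
      unfolding xt using d nonzero by (simp add: j_def flip: d_def)
    have j: "j t = 3 / d" "1 - j t = - 4 * t / d" "3 + j t = 12 * e / d"
      using d nonzero by (simp_all add: j_def d_def e_def field_simps)
    show "j t \<noteq> 0" using j d nonzero by auto
    have nj: "j t - 1 = 4 * t / d"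
      using d nonzero by (simp add: j_def d_def field_simps)
    show "i (j t) = t"
      unfolding i_def j(3) nj unfolding j(1) using d nonzero by simp
    have arg: "inverse ((t / e) ^ 3) * inverse (e ^ 4) * inverse (j t ^ 3)
        = - 256 / 27 * (j t / ((1 - j t) ^ 3 * (3 + j t)))"
    \<comment> \<open>At t = 0 and t = 1 both sides are 0 by the convention on division by 0, so
      this identity of rational functions holds at its poles too.\<close>
    proof (cases "t = 0 \<or> e = 0")
      case False
      then show ?thesis unfolding j(2,3) unfolding j(1) using d nonzero
        by (simp add: field_simps power3_eq_cube power4_eq_xxxx power2_eq_square)
    next
      case True
      then show ?thesis unfolding j(2,3) unfolding j(1) by auto
    qed
    have "(T ^\<^sub>c (-3)) (t / e) * (T ^\<^sub>c (-4)) e * (T ^\<^sub>c (-3) \<cdot>\<^sub>c quad_char) (1 / (1 - 4 / 3 * t))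
        = T (inverse ((t / e) ^ 3) * inverse (e ^ 4) * inverse (j t ^ 3)) * (quad_char (j t))"
      unfolding x char_mult_def char_pow_numeral [OF T] char_times [OF T] by (simp only: mult_ac)
    also have "\<dots> = T (- 256 / 27) * (quad_char (j t) * T (j t / ((1 - j t) ^ 3 * (3 + j t))))"
      unfolding arg char_times [OF T] by (simp only: mult_ac)
    finally show "(T ^\<^sub>c (-3)) (t / (1 - t)) * (T ^\<^sub>c (-4)) (1 - t)
          * (T ^\<^sub>c (-3) \<cdot>\<^sub>c quad_char) (1 / (1 - 4 / 3 * t))
        = T (- 256 / 27) * (quad_char (j t) * T (j t / ((1 - j t) ^ 3 * (3 + j t))))"
      by (simp only: e_def)
  qed (use nonzero twisted_mult_char [OF T] in auto)
  then show ?thesis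
    using char_uminus [OF T, of "256 / 27"] char_minus_one_mult_self [OF T]
    by (simp add: char_pow_at_minus_one [OF T] flip: mult.assoc)
qed

text \<open>Matching characters sends 0, 1, -3 and infinity to 1, 0, infinity and -3. This map is an
  involution, so \<open>i\<close> and \<open>j\<close> coincide.\<close>

lemma gauss_2F1_minus_one_third:
  "gauss_2F1 (T ^\<^sub>c (-3) \<cdot>\<^sub>c quad_char) (T ^\<^sub>c (-3)) (T ^\<^sub>c (-2) \<cdot>\<^sub>c quad_char) (- 1 / 3)
    = quad_char (- 1 :: 'a) * T (- 1) * T (256 / 27) * kernel_sum T / of_nat CARD('a)"
proof -
  define i :: "'a \<Rightarrow> 'a" where "i s = 3 * (1 - s) / (3 + s)" for s
  define j :: "'a \<Rightarrow> 'a" where "j t = 3 * (1 - t) / (3 + t)" for t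
  have "gauss_2F1 (T ^\<^sub>c (-3) \<cdot>\<^sub>c quad_char) (T ^\<^sub>c (-3)) (T ^\<^sub>c (-2) \<cdot>\<^sub>c quad_char) (- 1 / 3)
      = (T ^\<^sub>c (-3)) (- 1) * (T ^\<^sub>c (-2) \<cdot>\<^sub>c quad_char) (- 1) * T (256 / 27) * kernel_sum T / of_nat CARD('a)"
  proof (rule gauss_2F1_eq_kernel_sum [where b = "- 3" and i = i and j = j])
    fix s :: 'a assume "s \<noteq> - 3"
    then have s: "3 + s \<noteq> 0" by (simp add: add_eq_0_iff)
    have Di: "3 + i s = 12 / (3 + s)"
      using s nonzero by (simp add: i_def field_simps)
    show "- 1 / 3 * i s \<noteq> 1"
    proof
      assume "- 1 / 3 * i s = 1"
      then have "3 + i s = 0" using nonzero by (auto simp: field_simps add_eq_0_iff)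
      then show False using Di s nonzero by auto
    qed
    have "3 * (1 - i s) = 12 * s / (3 + s)"
      using s nonzero by (simp add: i_def field_simps)
    with Di show "j (i s) = s"
      using s nonzero unfolding j_def by simp
  next
    fix t :: 'a assume "- 1 / 3 * t \<noteq> 1"
    define d e where "d = 3 + t" and "e = 1 - t"
    have d: "d \<noteq> 0" using \<open>- 1 / 3 * t \<noteq> 1\<close> nonzero
      by (auto simp: d_def field_simps add_eq_0_iff)
    have xt: "1 - - 1 / 3 * t = d / 3" using nonzero by (simp add: d_def field_simps)
    have x: "1 / (1 - - 1 / 3 * t) = 3 / d"
      unfolding xt using d nonzero by (simp add: j_def flip: d_def)
    have j: "j t = 3 * e / d" "1 - j t = 4 * t / d" "3 + j t = 12 / d"
      using d nonzero by (simp_all add: j_def d_def e_def field_simps)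
    show "j t \<noteq> - 3" using j d nonzero by auto
    have nj: "3 * (1 - j t) = 12 * t / d"
      using d nonzero by (simp add: j_def d_def field_simps)
    show "i (j t) = t"
      unfolding i_def j(3) nj unfolding j(1) using d nonzero by simp
    have arg: "inverse ((t / e) ^ 3) * inverse (e ^ 2) * inverse ((3 / d) ^ 3)
        = 256 / 27 * (j t / ((1 - j t) ^ 3 * (3 + j t)))"
    proof (cases "t = 0 \<or> e = 0")
      case False
      then show ?thesis unfolding j(2,3) unfolding j(1) using d nonzero
        by (simp add: field_simps power3_eq_cube power4_eq_xxxx power2_eq_square)
    next
      case True
      then show ?thesis unfolding j(2,3) unfolding j(1) by auto
    qed
    have "(T ^\<^sub>c (-3)) (t / e) * (T ^\<^sub>c (-2) \<cdot>\<^sub>c quad_char) e * (T ^\<^sub>c (-3) \<cdot>\<^sub>c quad_char) (1 / (1 - - 1 / 3 * t))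
        = T (inverse ((t / e) ^ 3) * inverse (e ^ 2) * inverse ((3 / d) ^ 3)) * (quad_char e * quad_char (3 / d))"
      unfolding x char_mult_def char_pow_numeral [OF T] char_times [OF T] by (simp only: mult_ac)
    also have "\<dots> = T (256 / 27) * (quad_char (j t) * T (j t / ((1 - j t) ^ 3 * (3 + j t))))"
    proof -
      have "quad_char e * quad_char (3 / d) = quad_char (j t)"
        by (simp add: j(1) quad_char_simps divide_inverse inverse_quad_char)
      then show ?thesis unfolding arg char_times [OF T] by (simp only: mult_ac)
    qed
    finally show "(T ^\<^sub>c (-3)) (t / (1 - t)) * (T ^\<^sub>c (-2) \<cdot>\<^sub>c quad_char) (1 - t)
          * (T ^\<^sub>c (-3) \<cdot>\<^sub>c quad_char) (1 / (1 - - 1 / 3 * t))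
        = T (256 / 27) * (quad_char (j t) * T (j t / ((1 - j t) ^ 3 * (3 + j t))))"
      by (simp only: e_def)
  qed (use nonzero twisted_mult_char [OF T] in auto)
  then show ?thesis
    by (simp add: char_pow_at_minus_one [OF T] char_mult_def mult_ac)
qed

text \<open>Matching characters sends 0, 1, 1/4 and infinity to -3, 1, infinity and 0. The factor
  \<phi>(-3) arises from 1 / (1 - 4 t) = j(t) / (-3).\<close>

lemma gauss_2F1_four:
  "gauss_2F1 (T ^\<^sub>c (-3) \<cdot>\<^sub>c quad_char) (T ^\<^sub>c (-1)) (T ^\<^sub>c (-4)) 4
    = quad_char (- 3 :: 'a) * T (- 256) * kernel_sum T / of_nat CARD('a)"
proof -
  define i :: "'a \<Rightarrow> 'a" where "i s = (3 + s) / (4 * s)" for s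
  define j :: "'a \<Rightarrow> 'a" where "j t = - 3 / (1 - 4 * t)" for t
  have "gauss_2F1 (T ^\<^sub>c (-3) \<cdot>\<^sub>c quad_char) (T ^\<^sub>c (-1)) (T ^\<^sub>c (-4)) 4
      = (T ^\<^sub>c (-1)) (- 1) * (T ^\<^sub>c (-4)) (- 1) * (quad_char (- 3 :: 'a) * T 256) * kernel_sum T / of_nat CARD('a)"
  proof (rule gauss_2F1_eq_kernel_sum [where b = 0 and i = i and j = j])
    fix s :: 'a assume s: "s \<noteq> 0"
    have Di: "1 - 4 * i s = - 3 / s"
      using s nonzero by (simp add: i_def field_simps)
    show "4 * i s \<noteq> 1"
    proof
      assume "4 * i s = 1"
      then have "1 - 4 * i s = 0" using nonzero by (auto simp: field_simps add_eq_0_iff)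
      then show False using Di s nonzero by auto
    qed
    from Di show "j (i s) = s"
      using s nonzero unfolding j_def by simp
  next
    fix t :: 'a assume "4 * t \<noteq> 1"
    define d e where "d = 1 - 4 * t" and "e = 1 - t"
    have d: "d \<noteq> 0" using \<open>4 * t \<noteq> 1\<close> nonzero
      by (auto simp: d_def field_simps add_eq_0_iff)
    have xt: "1 - 4 * t = d" using nonzero by (simp add: d_def field_simps)
    have x: "1 / (1 - 4 * t) = j t / - 3"
      unfolding xt using d nonzero by (simp add: j_def flip: d_def)
    have j: "j t = - 3 / d" "1 - j t = 4 * e / d" "3 + j t = - 12 * t / d"
      using d nonzero by (simp_all add: j_def d_def e_def field_simps)
    show "j t \<noteq> 0" using j d nonzero by auto
    have nj: "3 + j t = - 12 * t / d"
      using d nonzero by (simp add: j_def d_def field_simps)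
    show "i (j t) = t"
      unfolding i_def j(3) nj unfolding j(1) using d nonzero by simp
    have arg: "inverse (t / e) * inverse (e ^ 4) * inverse ((j t / - 3) ^ 3)
        = 256 * (j t / ((1 - j t) ^ 3 * (3 + j t)))"
    proof (cases "t = 0 \<or> e = 0")
      case False
      then show ?thesis unfolding j(2,3) unfolding j(1) using d nonzero
        by (simp add: field_simps power3_eq_cube power4_eq_xxxx power2_eq_square)
    next
      case True
      then show ?thesis unfolding j(2,3) unfolding j(1) by auto
    qed
    have "(T ^\<^sub>c (-1)) (t / e) * (T ^\<^sub>c (-4)) e * (T ^\<^sub>c (-3) \<cdot>\<^sub>c quad_char) (1 / (1 - 4 * t))
        = T (inverse (t / e) * inverse (e ^ 4) * inverse ((j t / - 3) ^ 3)) * (quad_char (j t / - 3))"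
      unfolding x char_mult_def char_pow_numeral [OF T] char_times [OF T] by (simp only: mult_ac)
    also have "\<dots> = (quad_char (- 3 :: 'a) * T 256) * (quad_char (j t) * T (j t / ((1 - j t) ^ 3 * (3 + j t))))"
    proof -
      have "quad_char (j t / - 3) = quad_char (- 3 :: 'a) * quad_char (j t)"
        by (simp only: quad_char_simps divide_inverse [where ?'a = complex] inverse_quad_char mult.commute)
      then show ?thesis unfolding arg char_times [OF T] by (simp only: mult_ac)
    qed
    finally show "(T ^\<^sub>c (-1)) (t / (1 - t)) * (T ^\<^sub>c (-4)) (1 - t)
          * (T ^\<^sub>c (-3) \<cdot>\<^sub>c quad_char) (1 / (1 - 4 * t))
        = (quad_char (- 3 :: 'a) * T 256) * (quad_char (j t) * T (j t / ((1 - j t) ^ 3 * (3 + j t))))"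
      by (simp only: e_def)
  qed (use nonzero twisted_mult_char [OF T] in auto)
  then show ?thesis
    using char_uminus [OF T, of 256] by (simp add: char_pow_at_minus_one [OF T])
qed

text \<open>Matching characters sends 0, 1, 4 and infinity to 0, 1, infinity and -3. The factor
  \<phi>(3) arises from the 3 in the numerator of \<open>j\<close>.\<close>

lemma gauss_2F1_one_fourth:
  "gauss_2F1 (T ^\<^sub>c (-3) \<cdot>\<^sub>c quad_char) (T \<cdot>\<^sub>c quad_char) (T ^\<^sub>c (-2) \<cdot>\<^sub>c quad_char) (1 / 4)
    = quad_char (3 :: 'a) * T (- 4) * kernel_sum T / of_nat CARD('a)"
proof -
  define i :: "'a \<Rightarrow> 'a" where "i s = 4 * s / (3 + s)" for s
  define j :: "'a \<Rightarrow> 'a" where "j t = 3 * t / (4 - t)" for t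
  have "gauss_2F1 (T ^\<^sub>c (-3) \<cdot>\<^sub>c quad_char) (T \<cdot>\<^sub>c quad_char) (T ^\<^sub>c (-2) \<cdot>\<^sub>c quad_char) (1 / 4)
      = (T \<cdot>\<^sub>c quad_char) (- 1) * (T ^\<^sub>c (-2) \<cdot>\<^sub>c quad_char) (- 1) * (quad_char (3 :: 'a) * T 4) * kernel_sum T / of_nat CARD('a)"
  proof (rule gauss_2F1_eq_kernel_sum [where b = "- 3" and i = i and j = j])
    fix s :: 'a assume "s \<noteq> - 3"
    then have s: "3 + s \<noteq> 0" by (simp add: add_eq_0_iff)
    have Di: "4 - i s = 12 / (3 + s)"
      using s nonzero by (simp add: i_def field_simps)
    show "1 / 4 * i s \<noteq> 1"
    proof
      assume "1 / 4 * i s = 1"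
      then have "4 - i s = 0" using nonzero by (auto simp: field_simps add_eq_0_iff)
      then show False using Di s nonzero by auto
    qed
    have "3 * i s = 12 * s / (3 + s)"
      using s nonzero by (simp add: i_def field_simps)
    with Di show "j (i s) = s"
      using s nonzero unfolding j_def by simp
  next
    fix t :: 'a assume "1 / 4 * t \<noteq> 1"
    define d e where "d = 4 - t" and "e = 1 - t"
    have d: "d \<noteq> 0" using \<open>1 / 4 * t \<noteq> 1\<close> nonzero
      by (auto simp: d_def field_simps add_eq_0_iff)
    have xt: "1 - 1 / 4 * t = d / 4" using nonzero by (simp add: d_def field_simps)
    have x: "1 / (1 - 1 / 4 * t) = 4 / d"
      unfolding xt using d nonzero by (simp add: j_def flip: d_def)
    have j: "j t = 3 * t / d" "1 - j t = 4 * e / d" "3 + j t = 12 / d"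
      using d nonzero by (simp_all add: j_def d_def e_def field_simps)
    show "j t \<noteq> - 3" using j d nonzero by auto
    have nj: "4 * j t = 12 * t / d"
      using d nonzero by (simp add: j_def d_def field_simps)
    show "i (j t) = t"
      unfolding i_def j(3) nj unfolding j(1) using d nonzero by simp
    have arg: "t / e * inverse (e ^ 2) * inverse ((4 / d) ^ 3)
        = 4 * (j t / ((1 - j t) ^ 3 * (3 + j t)))"
    proof (cases "t = 0 \<or> e = 0")
      case False
      then show ?thesis unfolding j(2,3) unfolding j(1) using d nonzero
        by (simp add: field_simps power3_eq_cube power4_eq_xxxx power2_eq_square)
    next
      case True
      then show ?thesis unfolding j(2,3) unfolding j(1) by auto
    qed
    have "(T \<cdot>\<^sub>c quad_char) (t / e) * (T ^\<^sub>c (-2) \<cdot>\<^sub>c quad_char) e * (T ^\<^sub>c (-3) \<cdot>\<^sub>c quad_char) (1 / (1 - 1 / 4 * t))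
        = T (t / e * inverse (e ^ 2) * inverse ((4 / d) ^ 3)) * (quad_char (t / e) * quad_char e * quad_char (4 / d))"
      unfolding x char_mult_def char_pow_numeral [OF T] char_times [OF T] by (simp only: mult_ac)
    also have "\<dots> = (quad_char (3 :: 'a) * T 4) * (quad_char (j t) * T (j t / ((1 - j t) ^ 3 * (3 + j t))))"
    \<comment> \<open>The quadratic factors at t = 1 cancel only for nonzero \<open>e\<close>; at e
      = 0 both sides vanish.\<close>
    proof (cases "e = 0")
      case False
      have "quad_char (4 :: 'a) = 1" using quad_char_square [OF two] by simp
      then have "quad_char (t / e) * quad_char e * quad_char (4 / d) = quad_char (3 :: 'a) * quad_char (j t)"
        using quad_char_mult_self [OF False] quad_char_mult_self [OF three]
        by (simp add: j(1) quad_char_simps divide_inverse inverse_quad_char)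
      then show ?thesis unfolding arg char_times [OF T] by (simp only: mult_ac)
    qed (simp add: j(2) char_zero T quad_char_simps)
    finally show "(T \<cdot>\<^sub>c quad_char) (t / (1 - t)) * (T ^\<^sub>c (-2) \<cdot>\<^sub>c quad_char) (1 - t)
          * (T ^\<^sub>c (-3) \<cdot>\<^sub>c quad_char) (1 / (1 - 1 / 4 * t))
        = (quad_char (3 :: 'a) * T 4) * (quad_char (j t) * T (j t / ((1 - j t) ^ 3 * (3 + j t))))"
      by (simp only: e_def)
  qed (use nonzero twisted_mult_char [OF T] in auto)
  then show ?thesis
    using char_uminus [OF T, of 4] quad_char_mult_self [of "- 1 :: 'a"]
    by (simp add: char_pow_at_minus_one [OF T] char_mult_def)
qed

end

section \<open>Cubes and characters of order three\<close>

lemma of_nat_prime_nonzero: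
  assumes "prime p" "\<not> p dvd CARD('a :: {field, finite})"
  shows "(of_nat p :: 'a) \<noteq> 0"
proof
  assume "(of_nat p :: 'a) = 0"
  then have "CHAR('a) dvd p" by (simp add: of_nat_eq_0_iff_char_dvd)
  then have "CHAR('a) = p" using assms(1) by (auto simp: prime_nat_iff)
  then show False using CHAR_dvd_CARD [where ?'a = 'a] assms(2) by simp
qed

lemma eq_1_if_square_and_cube_eq_1:
  fixes z :: complex
  assumes "z ^ 2 = 1" "z ^ 3 = 1" shows "z = 1"
  using assms power_add [of z 2 1] by simp

lemma char_order_eq_3:
  assumes "mult_char S" "S ^\<^sub>c 3 = trivial_char" "S \<noteq> trivial_char"
  shows "char_order S = 3"
proof -
  have "S \<noteq> trivial_char \<Longrightarrow> \<exists>x. x \<noteq> 0 \<and> S x \<noteq> 1"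
    using eq_trivial_charI [OF assms(1)] by blast
  then obtain x where x: "x \<noteq> 0" "S x \<noteq> 1" using assms(3) by blast
  have "S x ^ 3 = 1"
    using trivial_charD [OF assms(2) x(1)] assms(1) by (simp add: char_pow_numeral char_power)
  then have "S x ^ 2 \<noteq> 1" using x(2) eq_1_if_square_and_cube_eq_1 by blast
  show ?thesis
    unfolding char_order_def
  proof (rule Least_equality)
    fix n assume n: "0 < n \<and> S ^\<^sub>c int n = trivial_char"
    then have "S x ^ n = 1"
      using trivial_charD [of _ x] x(1) assms(1) by (metis char_pow_of_nat char_power)
    then have "n \<noteq> 1" "n \<noteq> 2" using x(2) \<open>S x ^ 2 \<noteq> 1\<close> by auto
    then show "3 \<le> n" using n by linarith
  qed (use assms in simp)
qed

text \<open>\<open>LEAST\<close> yields information only once some exponent is known to work; q - 1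
  is one.\<close>

lemma char_order_3:
  fixes \<chi> :: "'a :: {field, finite} \<Rightarrow> complex"
  assumes \<chi>: "mult_char \<chi>" "char_order \<chi> = 3"
  shows "\<chi> \<noteq> trivial_char" "\<And>x. x \<noteq> 0 \<Longrightarrow> \<chi> x ^ 3 = 1"
proof -
  let ?P = "\<lambda>n. n > 0 \<and> \<chi> ^\<^sub>c int n = trivial_char"
  have "1 < CARD('a)" using card_mono [of "UNIV :: 'a set" "{0, 1}"] by simp
  then have pos: "CARD('a) - 1 > 0" by simp
  have "\<chi> ^\<^sub>c int (CARD('a) - 1) = trivial_char"
  proof (rule eq_trivial_charI [OF mult_char_char_pow [OF \<chi>(1)]])
    fix x :: 'a assume "x \<noteq> 0"
    then show "(\<chi> ^\<^sub>c int (CARD('a) - 1)) x = 1"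
      unfolding char_pow_of_nat [OF \<chi>(1) pos] by (simp only: power_card_minus_one [OF \<open>x \<noteq> 0\<close>] char_one [OF \<chi>(1)])
  qed
  with pos have ex: "\<exists>n. ?P n" by blast
  have "?P 3" using LeastI_ex [OF ex] \<chi>(2) unfolding char_order_def by simp
  then show "\<chi> x ^ 3 = 1" if "x \<noteq> 0" for x
    using trivial_charD [of _ x] that \<chi>(1) by (metis char_pow_of_nat char_power of_nat_numeral)
  show "\<chi> \<noteq> trivial_char"
  proof
    assume "\<chi> = trivial_char"
    then have "?P 1" by (simp add: fun_eq_iff char_pow_def trivial_char_def)
    then have "char_order \<chi> \<le> 1" unfolding char_order_def by (rule Least_le)
    then show False using \<chi>(2) by simp
  qed
qed

lemma sum_one_minus_cube_eq_0:
  fixes S :: "'a :: {field, finite} \<Rightarrow> complex"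
  assumes "CARD('a) mod 3 = 2"
  shows "(\<Sum>y\<in>UNIV. S (1 - y ^ 3)) - (\<Sum>x\<in>UNIV. S x) = 0"
proof -
  define m where "m = CARD('a) div 3"
  have m: "CARD('a) - 1 = 3 * m + 1"
    using div_mult_mod_eq [of "CARD('a)" 3] assms by (simp add: m_def)
  \<comment> \<open>The exponent inverts cubing, since 3 (2 m + 1) = 2 (q - 1) + 1.\<close>
  have "(y ^ 3) ^ (2 * m + 1) = y" for y :: 'a
  proof (cases "y = 0")
    case False
    have "(y ^ 3) ^ (2 * m + 1) = y ^ ((3 * m + 1) + (3 * m + 1) + 1)"
      unfolding power_mult [symmetric] by (rule arg_cong [of _ _ "\<lambda>k. y ^ k"]) simp
    also have "\<dots> = y ^ (3 * m + 1) * y ^ (3 * m + 1) * y"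
      by (simp only: power_add power_one_right)
    also have "y ^ (3 * m + 1) = 1" using power_card_minus_one [OF False] by (simp only: m)
    finally show ?thesis by simp
  qed simp
  then have "inj (\<lambda>y :: 'a. y ^ 3)" by (metis injI)
  then have "inj (\<lambda>y :: 'a. 1 - y ^ 3)" by (simp add: inj_def)
  then have "bij (\<lambda>y :: 'a. 1 - y ^ 3)" by (simp add: bij_def finite_UNIV_inj_surj)
  then show ?thesis by (simp add: sum.reindex_bij_betw [of "\<lambda>y. 1 - y ^ 3" UNIV UNIV S])
qed

text \<open>No exact count per point is attempted. The number of cube roots is at most
  \<open>h\<close> everywhere, a nonempty fibre over a unit being contained in a coset of the cube
  roots of unity. Both functions have total q, so they agree.\<close>

lemma card_cube_roots:
  fixes \<chi> :: "'a :: {field, finite} \<Rightarrow> complex"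
  assumes two: "(2 :: 'a) \<noteq> 0" and three: "(3 :: 'a) \<noteq> 0"
    and \<chi>: "mult_char \<chi>" "\<chi> \<noteq> trivial_char" and cube: "\<And>x. x \<noteq> 0 \<Longrightarrow> \<chi> x ^ 3 = 1"
  shows "of_nat (card {y. y ^ 3 = x}) = 1 + \<chi> x + \<chi> x ^ 2"
proof -
  let ?N = "\<lambda>x :: 'a. card {y. y ^ 3 = x}"
  define h :: "'a \<Rightarrow> nat" where "h x = (if x = 0 then 1 else if \<chi> x = 1 then 3 else 0)" for x
  have h: "of_nat (h x) = 1 + \<chi> x + \<chi> x ^ 2" for x
  proof -
    have "(\<chi> x - 1) * (1 + \<chi> x + \<chi> x ^ 2) = 0" if "x \<noteq> 0"
      using cube [OF that] by (simp add: algebra_simps power2_eq_square power3_eq_cube)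
    then show ?thesis by (auto simp: h_def char_zero [OF \<chi>(1)])
  qed
  have "of_nat (?N 1) = (2 + quad_char (- 3 :: 'a) :: complex)"
    by (rule card_cube_roots_of_unity [OF two three])
  also have "\<dots> = of_nat 3 \<or> \<dots> = of_nat 2 \<or> \<dots> = of_nat 1"
    by (auto simp: quad_char_def)
  finally have N1: "?N 1 \<le> 3" by (auto simp only: of_nat_eq_iff)
  have le: "?N x \<le> h x" for x
  proof (cases "\<exists>y. y ^ 3 = x")
    case True
    then obtain y where y: "x = y ^ 3" by blast
    show ?thesis
    proof (cases "y = 0")
      case False
      have "{z. z ^ 3 = x} \<subseteq> (\<lambda>w. y * w) ` {w. w ^ 3 = 1}"
      proof
        fix z assume "z \<in> {z. z ^ 3 = x}"
        then have "(z / y) ^ 3 = 1" using False y by (simp add: power_divide)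
        then show "z \<in> (\<lambda>w. y * w) ` {w. w ^ 3 = 1}"
          using False by (intro image_eqI [of _ _ "z / y"]) auto
      qed
      then have "?N x \<le> ?N 1" by (rule surj_card_le [OF finite])
      moreover have "h x = 3"
        using False cube [OF False] \<chi>(1) by (simp add: h_def y char_power)
      ultimately show ?thesis using N1 by simp
    qed (simp add: y h_def)
  qed simp
  have \<chi>2: "mult_char (\<chi> ^\<^sub>c 2)" by (rule mult_char_char_pow [OF \<chi>(1)])
  have "\<chi> ^\<^sub>c 2 \<noteq> trivial_char"
  proof
    assume eq: "\<chi> ^\<^sub>c 2 = trivial_char"
    have "\<chi> x = 1" if "x \<noteq> 0" for x
      using trivial_charD [OF eq that] cube [OF that] \<chi>(1)
      by (elim eq_1_if_square_and_cube_eq_1 [of "\<chi> x", rotated]) (simp add: char_pow_numeral char_power)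
    then show False using eq_trivial_charI [OF \<chi>(1)] \<chi>(2) by blast
  qed
  with \<chi>2 have "(\<Sum>x\<in>UNIV. \<chi> x ^ 2) = 0"
    using sum_nontrivial_char [OF \<chi>2] \<chi>(1) by (simp add: char_pow_numeral char_power)
  then have "of_nat (\<Sum>x\<in>UNIV. h x) = (of_nat CARD('a) :: complex)"
    using sum_nontrivial_char [OF \<chi>] by (simp add: h sum.distrib)
  then have "(\<Sum>x\<in>UNIV. h x) = CARD('a)" by (simp only: of_nat_eq_iff)
  also have "CARD('a) = (\<Sum>x\<in>UNIV. ?N x)"
    using sum.group [of UNIV UNIV "\<lambda>y. y ^ 3" "\<lambda>_ :: 'a. 1 :: nat"] by simp
  finally have "?N x = h x"
    using sum_mono_inv [of ?N UNIV h x] le by simp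
  then show ?thesis using h by simp
qed

text \<open>Grouping by x = y^3 weights S(1 - x) with 1 + \<chi> + \<chi>^2. The term 1 gives the
  subtracted sum; the others are Jacobi sums, and they are the binomials up to q because \<chi>(-1)
  = 1 and \<chi>^(-1) = \<chi>^2.\<close>

lemma sum_one_minus_cube_eq_char_binom:
  fixes S \<chi> :: "'a :: {field, finite} \<Rightarrow> complex"
  assumes two: "(2 :: 'a) \<noteq> 0" and three: "(3 :: 'a) \<noteq> 0"
    and \<chi>: "mult_char \<chi>" "char_order \<chi> = 3"
  shows "(\<Sum>y\<in>UNIV. S (1 - y ^ 3)) - (\<Sum>x\<in>UNIV. S x)
    = of_nat CARD('a) * (char_binom S \<chi> + char_binom S (\<chi> ^\<^sub>c 2))"
proof -
  note cube = char_order_3(2) [OF \<chi>]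
  have N: "of_nat (card {y. y ^ 3 = x}) = 1 + \<chi> x + \<chi> x ^ 2" for x
    by (rule card_cube_roots [OF two three \<chi>(1) char_order_3(1) [OF \<chi>]]) (rule cube)
  have "\<chi> (- 1) = 1"
    using cube [of "- 1"] char_minus_one_mult_self [OF \<chi>(1)] by (simp add: power3_eq_cube)
  have inv: "inverse (\<chi> x) = \<chi> x ^ 2" for x
  proof (cases "x = 0")
    case False
    then show ?thesis
      using cube [OF False] by (intro inverse_unique) (simp add: power3_eq_cube power2_eq_square mult.assoc)
  qed (simp add: \<chi> char_zero)
  have "\<chi> ^\<^sub>c (-1) = \<chi> ^\<^sub>c 2" "(\<chi> ^\<^sub>c 2) ^\<^sub>c (-1) = \<chi>"
    using \<chi>(1) by (simp_all add: fun_eq_iff char_pow_numeral mult_char_char_pow char_simps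
        flip: inv power_inverse)
  then have "of_nat CARD('a) * (char_binom S \<chi> + char_binom S (\<chi> ^\<^sub>c 2))
      = jacobi_sum S (\<chi> ^\<^sub>c 2) + jacobi_sum S \<chi>"
    using \<chi>(1) \<open>\<chi> (- 1) = 1\<close> by (simp add: char_binom_def char_pow_numeral char_one distrib_left)
  also have "\<dots> = (\<Sum>x\<in>UNIV. S (1 - x) * (\<chi> x + \<chi> x ^ 2))"
    unfolding jacobi_sum_commute [of S]
    using \<chi>(1) by (simp add: jacobi_sum_def char_pow_numeral char_power algebra_simps sum.distrib)
  also have "\<dots> = (\<Sum>x\<in>UNIV. S (1 - x) * of_nat (card {y. y ^ 3 = x})) - (\<Sum>x\<in>UNIV. S (1 - x))"
    by (simp add: N algebra_simps sum.distrib)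
  also have "(\<Sum>x\<in>UNIV. S (1 - x) * of_nat (card {y. y ^ 3 = x}))
      = (\<Sum>x\<in>UNIV. \<Sum>y | y \<in> UNIV \<and> y ^ 3 = x. S (1 - y ^ 3))"
    by (simp add: mult.commute)
  also have "\<dots> = (\<Sum>y\<in>UNIV. S (1 - y ^ 3))"
    by (rule sum.group) auto
  also have "(\<Sum>x\<in>UNIV. S (1 - x)) = (\<Sum>x\<in>UNIV. S x)"
    by (rule sum.reindex_bij_witness [of _ "\<lambda>x. 1 - x" "\<lambda>x. 1 - x"]) auto
  finally show ?thesis ..
qed

theorem theorem1p8:
  fixes p n q :: nat
    and S T :: "'a :: {field, finite} \<Rightarrow> complex"
  assumes "prime p" and "odd p" and "n \<ge> 1" and "q = p ^ n" and "CARD('a) = q"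
    and "mult_char S" and "char_order S \<noteq> 3"
    and "mult_char T" and "T ^\<^sub>c 2 = S"
  shows "(q mod 3 = 2 \<longrightarrow>
            gauss_2F1 (T ^\<^sub>c (-3) \<cdot>\<^sub>c quad_char) (T ^\<^sub>c (-3)) (S ^\<^sub>c (-2)) (4 / 3) = 0 \<and>
            gauss_2F1 (T ^\<^sub>c (-3) \<cdot>\<^sub>c quad_char) (T ^\<^sub>c (-3)) (S ^\<^sub>c (-1) \<cdot>\<^sub>c quad_char) (- 1 / 3) = 0 \<and>
            gauss_2F1 (T ^\<^sub>c (-3) \<cdot>\<^sub>c quad_char) (T ^\<^sub>c (-1)) (S ^\<^sub>c (-2)) 4 = 0 \<and>
            gauss_2F1 (T ^\<^sub>c (-3) \<cdot>\<^sub>c quad_char) (T \<cdot>\<^sub>c quad_char) (S ^\<^sub>c (-1) \<cdot>\<^sub>c quad_char) (1 / 4) = 0)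
       \<and> (q mod 3 = 1 \<longrightarrow> (\<forall>\<chi>\<^sub>3. mult_char \<chi>\<^sub>3 \<and> char_order \<chi>\<^sub>3 = 3 \<longrightarrow>
            gauss_2F1 (T ^\<^sub>c (-3) \<cdot>\<^sub>c quad_char) (T ^\<^sub>c (-3)) (S ^\<^sub>c (-2)) (4 / 3)
              = S (8 / 27) * jacobi_sum (T ^\<^sub>c (-1)) (T ^\<^sub>c 3 \<cdot>\<^sub>c quad_char) / jacobi_sum quad_char S
                * (char_binom S \<chi>\<^sub>3 + char_binom S (\<chi>\<^sub>3 ^\<^sub>c 2)) \<and>
            gauss_2F1 (T ^\<^sub>c (-3) \<cdot>\<^sub>c quad_char) (T ^\<^sub>c (-3)) (S ^\<^sub>c (-1) \<cdot>\<^sub>c quad_char) (- 1 / 3)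
              = S (8 / 27) * jacobi_sum (T ^\<^sub>c (-1)) (T ^\<^sub>c 3 \<cdot>\<^sub>c quad_char)
                  / ((T \<cdot>\<^sub>c quad_char) (- 1) * jacobi_sum quad_char S)
                * (char_binom S \<chi>\<^sub>3 + char_binom S (\<chi>\<^sub>3 ^\<^sub>c 2)) \<and>
            gauss_2F1 (T ^\<^sub>c (-3) \<cdot>\<^sub>c quad_char) (T ^\<^sub>c (-1)) (S ^\<^sub>c (-2)) 4
              = T (- 64 / 27) * jacobi_sum (T ^\<^sub>c (-1)) (T ^\<^sub>c 3 \<cdot>\<^sub>c quad_char)
                  / (quad_char (- 3 :: 'a) * jacobi_sum quad_char S)
                * (char_binom S \<chi>\<^sub>3 + char_binom S (\<chi>\<^sub>3 ^\<^sub>c 2)) \<and>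
            gauss_2F1 (T ^\<^sub>c (-3) \<cdot>\<^sub>c quad_char) (T \<cdot>\<^sub>c quad_char) (S ^\<^sub>c (-1) \<cdot>\<^sub>c quad_char) (1 / 4)
              = T (- 1 / 27) * jacobi_sum (T ^\<^sub>c (-1)) (T ^\<^sub>c 3 \<cdot>\<^sub>c quad_char)
                  / (quad_char (3 :: 'a) * jacobi_sum quad_char S)
                * (char_binom S \<chi>\<^sub>3 + char_binom S (\<chi>\<^sub>3 ^\<^sub>c 2))))"
proof -
  let ?F = gauss_2F1 and ?\<phi> = "quad_char :: 'a \<Rightarrow> complex"
  note T = \<open>mult_char T\<close> and S = \<open>mult_char S\<close>
  have Sx: "S x = T (x ^ 2)" for x
    using T \<open>T ^\<^sub>c 2 = S\<close> by (auto simp: char_pow_numeral)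
  have two: "(2 :: 'a) \<noteq> 0"
    using of_nat_prime_nonzero [where ?'a = 'a, of 2] assms(2,4,5) by simp
  have three: "(3 :: 'a) \<noteq> 0" if "\<not> 3 dvd q"
    using of_nat_prime_nonzero [where ?'a = 'a, of 3] that \<open>CARD('a) = q\<close> by simp
  \<comment> \<open>The number \<open>m\<close> stands for the bracket of binomials, so both residue
    classes are covered: m = 0 when cubing is a bijection, and the bracket itself otherwise.\<close>
  have evaluations: "?F (T ^\<^sub>c (-3) \<cdot>\<^sub>c ?\<phi>) (T ^\<^sub>c (-3)) (S ^\<^sub>c (-2)) (4 / 3) = S (8 / 27) * K"
      "?F (T ^\<^sub>c (-3) \<cdot>\<^sub>c ?\<phi>) (T ^\<^sub>c (-3)) (S ^\<^sub>c (-1) \<cdot>\<^sub>c ?\<phi>) (- 1 / 3)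
        = S (8 / 27) / (T \<cdot>\<^sub>c ?\<phi>) (- 1) * K"
      "?F (T ^\<^sub>c (-3) \<cdot>\<^sub>c ?\<phi>) (T ^\<^sub>c (-1)) (S ^\<^sub>c (-2)) 4 = T (- 64 / 27) / ?\<phi> (- 3) * K"
      "?F (T ^\<^sub>c (-3) \<cdot>\<^sub>c ?\<phi>) (T \<cdot>\<^sub>c ?\<phi>) (S ^\<^sub>c (-1) \<cdot>\<^sub>c ?\<phi>) (1 / 4)
        = T (- 1 / 27) / ?\<phi> 3 * K"
    if three: "(3 :: 'a) \<noteq> 0"
      and M: "(\<Sum>y\<in>UNIV. S (1 - y ^ 3)) - (\<Sum>x\<in>UNIV. S x) = of_nat CARD('a) * m"
      and K: "K = jacobi_sum (T ^\<^sub>c (-1)) (T ^\<^sub>c 3 \<cdot>\<^sub>c ?\<phi>) / jacobi_sum ?\<phi> S * m"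
    for K m
  proof -
    note nz = numeral_nonzero [OF two three]
    have 108: "(108 :: 'a) \<noteq> 0" using no_zero_divisors [OF nz(1) nz(3)] by simp
    have 2916: "(2916 :: 'a) \<noteq> 0" using no_zero_divisors [OF 108 nz(3)] by simp
    have 729: "(729 :: 'a) \<noteq> 0" using no_zero_divisors [OF nz(3) nz(3)] by simp
    have S3: "S ^\<^sub>c 3 \<noteq> trivial_char" if "S \<noteq> trivial_char"
      using char_order_eq_3 [OF S _ that] \<open>char_order S \<noteq> 3\<close> by blast
    have J: "jacobi_sum ?\<phi> S \<noteq> 0"
      using jacobi_sum_nonzero [OF mult_char_quad quad_char_nontrivial [OF two] S]
        jacobi_sum_quad_trivial [OF two] by (cases "S = trivial_char") auto
    have T108: "T 108 \<noteq> 0" using T 108 by (simp add: char_eq_0_iff)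
    have "jacobi_sum ?\<phi> S * T 108 * kernel_sum T
        = jacobi_sum (T ^\<^sub>c (-1)) (T ^\<^sub>c 3 \<cdot>\<^sub>c ?\<phi>) * (of_nat CARD('a) * m)"
      using kernel_sum_eq [OF two three T] S3 \<open>T ^\<^sub>c 2 = S\<close> M by simp
    then have "kernel_sum T / of_nat CARD('a) = K / T 108"
      using J T108 by (simp add: K field_simps)
    then have E: "T a * kernel_sum T / of_nat CARD('a) = T (a / 108) * K" for a
      using T by (simp add: char_divide flip: times_divide_eq_right)
    then have E': "c * T a * kernel_sum T / of_nat CARD('a) = c * T (a / 108) * K" for a c
      by (simp add: mult.assoc flip: times_divide_eq_right)
    \<comment> \<open>Dividing by the 108 of \<open>kernel_sum_eq\<close> gives the constants of the
      theorem; 64/729 is the square of 8/27, whence S (8 / 27).\<close>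
    have frac: "256 / 27 / 108 = (64 / 729 :: 'a)" "- 256 / 108 = (- 64 / 27 :: 'a)"
        "- 4 / 108 = (- 1 / 27 :: 'a)"
      using nz 108 729 2916 by (simp_all add: field_simps)
    have S827: "S (8 / 27) = T (64 / 729)" by (simp add: Sx power_divide)
    have Spow: "S ^\<^sub>c (-2) = T ^\<^sub>c (-4)" "S ^\<^sub>c (-1) = T ^\<^sub>c (-2)"
      using S T by (simp_all add: fun_eq_iff char_pow_numeral Sx power_inverse flip: power_mult)
    have inv: "inverse (T (- 1)) = T (- 1)"
      using char_minus_one_mult_self [OF T] by (rule inverse_unique)
    note simps = divide_inverse [of "_ :: complex"] inverse_mult_distrib inverse_quad_char inv
    show "?F (T ^\<^sub>c (-3) \<cdot>\<^sub>c ?\<phi>) (T ^\<^sub>c (-3)) (S ^\<^sub>c (-2)) (4 / 3) = S (8 / 27) * K"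
      unfolding Spow gauss_2F1_four_thirds [OF two three T] E frac S827 ..
    show "?F (T ^\<^sub>c (-3) \<cdot>\<^sub>c ?\<phi>) (T ^\<^sub>c (-3)) (S ^\<^sub>c (-1) \<cdot>\<^sub>c ?\<phi>) (- 1 / 3)
        = S (8 / 27) / (T \<cdot>\<^sub>c ?\<phi>) (- 1) * K"
      unfolding Spow gauss_2F1_minus_one_third [OF two three T] E' frac
      unfolding S827 char_mult_def simps
      by (simp only: mult_ac)
    show "?F (T ^\<^sub>c (-3) \<cdot>\<^sub>c ?\<phi>) (T ^\<^sub>c (-1)) (S ^\<^sub>c (-2)) 4 = T (- 64 / 27) / ?\<phi> (- 3) * K"
      unfolding Spow gauss_2F1_four [OF two three T] E' frac
      unfolding simps
      by (simp only: mult_ac)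
    show "?F (T ^\<^sub>c (-3) \<cdot>\<^sub>c ?\<phi>) (T \<cdot>\<^sub>c ?\<phi>) (S ^\<^sub>c (-1) \<cdot>\<^sub>c ?\<phi>) (1 / 4)
        = T (- 1 / 27) / ?\<phi> 3 * K"
      unfolding Spow gauss_2F1_one_fourth [OF two three T] E' frac
      unfolding simps
      by (simp only: mult_ac)
  qed
  show ?thesis
  proof (intro conjI impI allI)
    assume "q mod 3 = 2"
    then have q: "\<not> 3 dvd q" "CARD('a) mod 3 = 2"
      using \<open>CARD('a) = q\<close> by (auto simp: dvd_eq_mod_eq_0)
    note evaluations [OF three [OF q(1)] _ refl, of 0]
    then show "?F (T ^\<^sub>c (-3) \<cdot>\<^sub>c ?\<phi>) (T ^\<^sub>c (-3)) (S ^\<^sub>c (-2)) (4 / 3) = 0"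
      "?F (T ^\<^sub>c (-3) \<cdot>\<^sub>c ?\<phi>) (T ^\<^sub>c (-3)) (S ^\<^sub>c (-1) \<cdot>\<^sub>c ?\<phi>) (- 1 / 3) = 0"
      "?F (T ^\<^sub>c (-3) \<cdot>\<^sub>c ?\<phi>) (T ^\<^sub>c (-1)) (S ^\<^sub>c (-2)) 4 = 0"
      "?F (T ^\<^sub>c (-3) \<cdot>\<^sub>c ?\<phi>) (T \<cdot>\<^sub>c ?\<phi>) (S ^\<^sub>c (-1) \<cdot>\<^sub>c ?\<phi>) (1 / 4) = 0"
      using sum_one_minus_cube_eq_0 [OF q(2)] by simp_all
  next
    fix \<chi>\<^sub>3 :: "'a \<Rightarrow> complex"
    assume "q mod 3 = 1" and \<chi>: "mult_char \<chi>\<^sub>3 \<and> char_order \<chi>\<^sub>3 = 3"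
    from \<open>q mod 3 = 1\<close> have 3: "(3 :: 'a) \<noteq> 0" by (intro three) (simp add: dvd_eq_mod_eq_0)
    note evaluations [OF 3 sum_one_minus_cube_eq_char_binom [OF two 3 conjunct1 [OF \<chi>] conjunct2 [OF \<chi>]] refl]
    then show "?F (T ^\<^sub>c (-3) \<cdot>\<^sub>c ?\<phi>) (T ^\<^sub>c (-3)) (S ^\<^sub>c (-2)) (4 / 3)
              = S (8 / 27) * jacobi_sum (T ^\<^sub>c (-1)) (T ^\<^sub>c 3 \<cdot>\<^sub>c ?\<phi>) / jacobi_sum ?\<phi> S
                * (char_binom S \<chi>\<^sub>3 + char_binom S (\<chi>\<^sub>3 ^\<^sub>c 2))"
      "?F (T ^\<^sub>c (-3) \<cdot>\<^sub>c ?\<phi>) (T ^\<^sub>c (-3)) (S ^\<^sub>c (-1) \<cdot>\<^sub>c ?\<phi>) (- 1 / 3)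
              = S (8 / 27) * jacobi_sum (T ^\<^sub>c (-1)) (T ^\<^sub>c 3 \<cdot>\<^sub>c ?\<phi>)
                  / ((T \<cdot>\<^sub>c ?\<phi>) (- 1) * jacobi_sum ?\<phi> S)
                * (char_binom S \<chi>\<^sub>3 + char_binom S (\<chi>\<^sub>3 ^\<^sub>c 2))"
      "?F (T ^\<^sub>c (-3) \<cdot>\<^sub>c ?\<phi>) (T ^\<^sub>c (-1)) (S ^\<^sub>c (-2)) 4
              = T (- 64 / 27) * jacobi_sum (T ^\<^sub>c (-1)) (T ^\<^sub>c 3 \<cdot>\<^sub>c ?\<phi>)
                  / (?\<phi> (- 3) * jacobi_sum ?\<phi> S)
                * (char_binom S \<chi>\<^sub>3 + char_binom S (\<chi>\<^sub>3 ^\<^sub>c 2))"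
      "?F (T ^\<^sub>c (-3) \<cdot>\<^sub>c ?\<phi>) (T \<cdot>\<^sub>c ?\<phi>) (S ^\<^sub>c (-1) \<cdot>\<^sub>c ?\<phi>) (1 / 4)
              = T (- 1 / 27) * jacobi_sum (T ^\<^sub>c (-1)) (T ^\<^sub>c 3 \<cdot>\<^sub>c ?\<phi>)
                  / (?\<phi> 3 * jacobi_sum ?\<phi> S)
                * (char_binom S \<chi>\<^sub>3 + char_binom S (\<chi>\<^sub>3 ^\<^sub>c 2))"
      by (simp_all only: times_divide_eq_left times_divide_eq_right divide_divide_eq_left mult.assoc)
  qed
qed

end
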